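(* Let $\pi=(d_0,\ldots,d_{n-1})$ be a tree sequence and let $T$ be a tree that has minimal algebraic connectivity among all trees with degree sequence $\pi$. Then $T$ is a caterpillar. Moreover, let $f$ be a Fiedler vector of $T$, and let $P$ be the path induced by all non-pendant vertices $v$ of $T$ with $f(v)\ge 0$ (respectively, with $f(v)\le 0$). Then the degree sequence of $T$ along $P$ is monotone, with its minimum at the characteristic vertex or characteristic edge of $f$.
   Context: All graphs are finite, simple and undirected. The Laplacian of a graph $G$ is $L(G)=D(G)-A(G)$, where $A(G)$ is the adjacency matrix and $D(G)$ the diagonal matrix of vertex degrees. Its eigenvalues are non-negative and the smallest is $0$; the second smallest eigenvalue $\alpha(G)$ is the algebraic connectivity, and an eigenvector for $\alpha(G)$ is a Fiedler vector. A tree sequence is a sequence of non-negative integers that is the degree sequence of some tree. A pendant vertex is a vertex of degree $1$. A caterpillar is a tree in which removing all pendant vertices gives a path. For a Fiedler vector $f$ of a tree, either there is an edge $uw$ with $f(u)f(w)<0$ (the characteristic edge), or there is a single vertex $v_0$ with $f(v_0)=0$ adjacent to a vertex where $f$ is nonzero (the characteristic vertex); exactly one of these cases occurs, and the vertices with $f\ge0$, as well as those with $f\le 0$, induce connected subgraphs. *)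

theory Defs
  imports "HOL-Analysis.Analysis" "HOL-Library.Multiset" "Graph_Theory.Graph_Theory"
begin

text \<open>
  A finite simple undirected graph is a finite, symmetric, loop-free digraph without
  parallel arcs: each edge \<open>uw\<close> is the pair of arcs \<open>(u, w)\<close> and \<open>(w, u)\<close>.
  This is the locale predicate \<^const>\<open>pair_graph\<close>.
\<close>

definition vertex_degree :: "'v pair_pre_digraph \<Rightarrow> 'v \<Rightarrow> nat" where
  "vertex_degree G v = out_degree (with_proj G) v"

text \<open>
  \<^const>\<open>tree\<close> and \<^const>\<open>forest\<close> are unsuitable for symmetric digraphs: there every edge
  yields a directed cycle of length 2.  The cycles of the undirected graph are the
  directed cycles of length at least 3.
\<close>

definition is_tree :: "'v pair_pre_digraph \<Rightarrow> bool" where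
  "is_tree G \<longleftrightarrow> pair_graph G \<and> Digraph_Component.connected (with_proj G) \<and>
     \<not> (\<exists>p. pre_digraph.cycle (with_proj G) p \<and> 3 \<le> length p)"

definition has_degree_sequence :: "'v pair_pre_digraph \<Rightarrow> nat list \<Rightarrow> bool" where
  "has_degree_sequence G \<pi> \<longleftrightarrow> image_mset (vertex_degree G) (mset_set (pverts G)) = mset \<pi>"

definition tree_sequence :: "nat list \<Rightarrow> bool" where
  "tree_sequence \<pi> \<longleftrightarrow> (\<exists>G :: nat pair_pre_digraph. is_tree G \<and> has_degree_sequence G \<pi>)"

text \<open>
  The vertex set is all of the finite type \<open>'v\<close>, which also indexes the matrices below.
  Every tree with \<open>CARD('v)\<close> vertices has an isomorphic copy on \<open>'v\<close>.
\<close>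

definition trees_with_degree_sequence :: "nat list \<Rightarrow> 'v::finite pair_pre_digraph set" where
  "trees_with_degree_sequence \<pi> =
     {G. is_tree G \<and> pverts G = UNIV \<and> has_degree_sequence G \<pi>}"

definition pendant_vertices :: "'v pair_pre_digraph \<Rightarrow> 'v set" where
  "pendant_vertices G = {v \<in> pverts G. vertex_degree G v = 1}"

text \<open>
  The graph \<open>H\<close> is a path that visits its vertices in the order \<open>vs\<close>.
  The graph without vertices counts as a path; it arises from \<open>K\<^sub>2\<close>
  by removing the two pendant vertices.
\<close>

definition path_along :: "('v, 'e) pre_digraph \<Rightarrow> 'v list \<Rightarrow> bool" where
  "path_along H vs \<longleftrightarrow> distinct vs \<and> verts H = set vs \<and>
     arcs_ends H = set (zip vs (tl vs)) \<union> (set (zip vs (tl vs)))\<inverse>"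

definition caterpillar :: "'v pair_pre_digraph \<Rightarrow> bool" where
  "caterpillar G \<longleftrightarrow> is_tree G \<and>
     (\<exists>vs. path_along (with_proj G \<restriction> (pverts G - pendant_vertices G)) vs)"

definition adjacency_matrix :: "'v::finite pair_pre_digraph \<Rightarrow> real^'v^'v" where
  "adjacency_matrix G = (\<chi> u v. if (u, v) \<in> parcs G then 1 else 0)"

definition degree_matrix :: "'v::finite pair_pre_digraph \<Rightarrow> real^'v^'v" where
  "degree_matrix G = (\<chi> u v. if u = v then real (vertex_degree G u) else 0)"

definition laplacian :: "'v::finite pair_pre_digraph \<Rightarrow> real^'v^'v" where
  "laplacian G = degree_matrix G - adjacency_matrix G"

definition eigenvector :: "real^'n^'n \<Rightarrow> real \<Rightarrow> real^'n \<Rightarrow> bool" where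
  "eigenvector A \<mu> x \<longleftrightarrow> x \<noteq> 0 \<and> A *v x = \<mu> *\<^sub>R x"

definition eigenvalue :: "real^'n^'n \<Rightarrow> real \<Rightarrow> bool" where
  "eigenvalue A \<mu> \<longleftrightarrow> (\<exists>x. eigenvector A \<mu> x)"

text \<open>
  The eigenvalues of a real symmetric matrix, each repeated according to its multiplicity
  (for such a matrix the geometric and the algebraic multiplicity agree).
\<close>

definition eigenvalue_mset :: "real^'n^'n \<Rightarrow> real multiset" where
  "eigenvalue_mset A =
     (\<Sum>\<mu> | eigenvalue A \<mu>. replicate_mset (dim {x. A *v x = \<mu> *\<^sub>R x}) \<mu>)"

definition algebraic_connectivity :: "'v::finite pair_pre_digraph \<Rightarrow> real" where
  "algebraic_connectivity G = sorted_list_of_multiset (eigenvalue_mset (laplacian G)) ! 1"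

definition fiedler_vector :: "'v::finite pair_pre_digraph \<Rightarrow> real^'v \<Rightarrow> bool" where
  "fiedler_vector G f \<longleftrightarrow> eigenvector (laplacian G) (algebraic_connectivity G) f"

definition characteristic_edge ::
  "'v::finite pair_pre_digraph \<Rightarrow> real^'v \<Rightarrow> 'v \<Rightarrow> 'v \<Rightarrow> bool" where
  "characteristic_edge G f u w \<longleftrightarrow> (u, w) \<in> parcs G \<and> f $ u * f $ w < 0"

definition characteristic_vertex ::
  "'v::finite pair_pre_digraph \<Rightarrow> real^'v \<Rightarrow> 'v \<Rightarrow> bool" where
  "characteristic_vertex G f v\<^sub>0 \<longleftrightarrow>
     {v \<in> pverts G. f $ v = 0 \<and> (\<exists>w. (v, w) \<in> parcs G \<and> f $ w \<noteq> 0)} = {v\<^sub>0}"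

end

theory Submission
  imports Defs
begin

text \<open>
  Let \<open>f\<close> be a Fiedler vector of \<open>T\<close>, and let \<open>u\<close>, \<open>v\<close> be distinct vertices.  Detach some of the
  branches at \<open>u\<close> and some at \<open>v\<close> (none of them containing the \<open>u\<close>-\<open>v\<close> path) and reattach them
  at the other vertex, in such a way that the degrees of \<open>u\<close> and \<open>v\<close> are kept or swapped.  Shift
  \<open>f\<close> by \<open>\<plusminus>(f v - f u)\<close> on the moved branches.  All edge differences, hence the Dirichlet
  energy, stay the same, while the variance changes by twice the scalar product of \<open>f\<close> with the
  shift plus a term that is positive if \<open>f u \<noteq> f v\<close>.  So minimality of \<open>T\<close> decides the sign of the
  difference of the sums of \<open>f\<close> over the exchanged branches.  The sum of \<open>f\<close> over a branch with
  root \<open>r\<close> at \<open>u\<close> is \<open>(f r - f u) / \<alpha>\<close>, and this turns the sign rule into the purely local lemma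
  \<open>exchange\<close>, from which everything else follows by combinatorics: at a non-pendant vertex, \<open>f\<close>
  increases towards at most one non-pendant neighbour and decreases towards at most one, so the
  non-pendant vertices form a path along which \<open>f\<close> is strictly monotone; and if the degree dropped
  along that path away from the zero of \<open>f\<close>, moving pendant vertices outwards would lower \<open>\<alpha>\<close>.
\<close>

section \<open>The second smallest eigenvalue\<close>

text \<open>First variation: \<open>x\<close> is perturbed along the residual
  \<open>y = A *v x - \<mu> *\<^sub>R x\<close>, which is again orthogonal to \<open>1\<close>. The
  gap in the Rayleigh inequality is then quadratic in the step \<open>t\<close> with linear
  coefficient \<open>2 * b\<close>; being nonnegative for all \<open>t\<close>, it forces
  \<open>b = 0\<close>.\<close>

lemma min_on_subspace_imp_eigenvector:
  fixes A :: "real^'n^'n" and \<mu> :: real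
  assumes sym: "\<And>x y. x \<bullet> (A *v y) = (A *v x) \<bullet> y"
    and one: "A *v 1 = 0"
    and min: "\<And>x. x \<bullet> 1 = 0 \<Longrightarrow> \<mu> * (x \<bullet> x) \<le> x \<bullet> (A *v x)"
    and x: "x \<bullet> 1 = 0" "x \<bullet> (A *v x) = \<mu> * (x \<bullet> x)"
  shows "A *v x = \<mu> *\<^sub>R x"
proof -
  define y where "y = A *v x - \<mu> *\<^sub>R x"
  define b where "b = y \<bullet> y"
  define c where "c = y \<bullet> (A *v y) - \<mu> * (y \<bullet> y)"
  have Ax1: "(A *v x) \<bullet> 1 = 0"
    using sym[of x "1"] one by simp
  then have y1: "y \<bullet> 1 = 0"
    using x by (simp add: y_def inner_diff_left)
  have yAx: "y \<bullet> (A *v x) - \<mu> * (y \<bullet> x) = b"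
    by (simp add: b_def y_def inner_diff_right inner_diff_left inner_commute algebra_simps)
  have q: "0 \<le> 2 * t * b + t\<^sup>2 * c" for t :: real
  proof -
    have "(x + t *\<^sub>R y) \<bullet> 1 = 0" using x y1 by (simp add: inner_add_left)
    from min[OF this] have "\<mu> * ((x + t *\<^sub>R y) \<bullet> (x + t *\<^sub>R y)) \<le> (x + t *\<^sub>R y) \<bullet> (A *v (x + t *\<^sub>R y))" .
    moreover have "A *v (x + t *\<^sub>R y) = A *v x + t *\<^sub>R (A *v y)"
      by (simp add: matrix_vector_right_distrib matrix_vector_mult_scaleR)
    moreover have "x \<bullet> (A *v y) = y \<bullet> (A *v x)" using sym[of x y] inner_commute by metis
    ultimately have "\<mu> * (x \<bullet> x) + 2 * t * \<mu> * (y \<bullet> x) + t\<^sup>2 * \<mu> * (y \<bullet> y)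
       \<le> x \<bullet> (A *v x) + 2 * t * (y \<bullet> (A *v x)) + t\<^sup>2 * (y \<bullet> (A *v y))"
      by (simp add: inner_add_left inner_add_right inner_commute power2_eq_square algebra_simps)
    then show ?thesis using x yAx unfolding c_def
      by (simp add: algebra_simps flip: yAx)
  qed
  have c0: "0 \<le> c" using min[OF y1] by (simp add: c_def)
  have "b = 0"
  proof (rule ccontr)
    assume "b \<noteq> 0"
    \<comment> \<open>Dividing by \<open>c + 1\<close> rather than \<open>c\<close> covers
      \<open>c = 0\<close> as well; this \<open>t\<close> still makes the quadratic
      negative.\<close>
    define t where "t = - b / (c + 1)"
    have t: "t * (c + 1) = - b" using c0 by (simp add: t_def)
    have "(c + 1) * (2 * t * b + t\<^sup>2 * c) = 2 * b * (t * (c + 1)) + t * c * (t * (c + 1))"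
      by (simp add: power2_eq_square algebra_simps)
    also have "\<dots> = - 2 * b\<^sup>2 - b * (t * c)" using t by (simp add: power2_eq_square)
    also have "t * c = - b - t" using t by (simp add: algebra_simps)
    finally have "(c + 1) * (2 * t * b + t\<^sup>2 * c) = - b\<^sup>2 + b * t"
      by (simp add: power2_eq_square algebra_simps)
    moreover have "b * t \<le> 0" using c0 by (simp add: t_def)
    moreover have "0 \<le> (c + 1) * (2 * t * b + t\<^sup>2 * c)" using q c0 by simp
    ultimately show False using \<open>b \<noteq> 0\<close> by (smt (verit) zero_less_power2)
  qed
  then show ?thesis by (simp add: b_def y_def)
qed

text \<open>Eigenvectors picked for distinct eigenvalues are orthogonal, hence independent.
  Finiteness gives \<open>eigenvalue_mset\<close> its meaning, since a sum over an infinite set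
  would be the empty multiset.\<close>

lemma finite_eigenvalues_symmetric:
  fixes A :: "real^'n^'n"
  assumes sym: "\<And>x y. x \<bullet> (A *v y) = (A *v x) \<bullet> y"
  shows "finite {\<mu>. eigenvalue A \<mu>}"
proof -
  define X where "X \<mu> = (SOME x. eigenvector A \<mu> x)" for \<mu>
  have X: "eigenvector A \<mu> (X \<mu>)" if "eigenvalue A \<mu>" for \<mu>
    using that unfolding eigenvalue_def X_def by (rule someI_ex)
  have orth: "X \<mu> \<bullet> X \<nu> = 0" if "eigenvalue A \<mu>" "eigenvalue A \<nu>" "\<mu> \<noteq> \<nu>" for \<mu> \<nu>
  proof -
    have "\<nu> * (X \<mu> \<bullet> X \<nu>) = \<mu> * (X \<mu> \<bullet> X \<nu>)"
      using sym[of "X \<mu>" "X \<nu>"] X[OF that(1)] X[OF that(2)] by (simp add: eigenvector_def)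
    then show ?thesis using that(3) by simp
  qed
  have inj: "inj_on X {\<mu>. eigenvalue A \<mu>}"
  proof (rule inj_onI, rule ccontr)
    fix \<mu> \<nu> assume *: "\<mu> \<in> {\<mu>. eigenvalue A \<mu>}" "\<nu> \<in> {\<mu>. eigenvalue A \<mu>}" "X \<mu> = X \<nu>" "\<mu> \<noteq> \<nu>"
    then have "X \<mu> \<bullet> X \<mu> = 0" using orth[of \<mu> \<nu>] by simp
    then show False using X[of \<mu>] * by (simp add: eigenvector_def)
  qed
  have "independent (X ` {\<mu>. eigenvalue A \<mu>})"
  proof (rule pairwise_orthogonal_independent)
    show "pairwise orthogonal (X ` {\<mu>. eigenvalue A \<mu>})"
      using orth by (auto simp: pairwise_def orthogonal_def)
    show "0 \<notin> X ` {\<mu>. eigenvalue A \<mu>}"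
      using X by (auto simp: eigenvector_def)
  qed
  then have "finite (X ` {\<mu>. eigenvalue A \<mu>})" by (rule independent_imp_finite)
  then show ?thesis using inj by (rule finite_imageD)
qed

text \<open>The quadratic form attains its minimum on the compact unit sphere of the complement of
  \<open>1\<close>; homogeneity extends the bound to the whole complement.\<close>

lemma eigenvector_min_on_subspace:
  fixes A :: "real^'n^'n"
  assumes sym: "\<And>x y. x \<bullet> (A *v y) = (A *v x) \<bullet> y"
    and one: "A *v 1 = 0"
    and card: "2 \<le> CARD('n)"
  obtains \<mu> x where "eigenvector A \<mu> x" "x \<bullet> 1 = 0"
    "\<And>y. y \<bullet> 1 = 0 \<Longrightarrow> \<mu> * (y \<bullet> y) \<le> y \<bullet> (A *v y)"
proof -
  define S where "S = {x :: real^'n. norm x = 1 \<and> x \<bullet> 1 = 0}"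
  have "compact S"
  proof -
    have "S = sphere 0 1 \<inter> {x. x \<bullet> 1 = 0}" by (auto simp: S_def dist_norm)
    moreover have "closed {x :: real^'n. x \<bullet> 1 = 0}"
      by (intro closed_Collect_eq continuous_intros)
    ultimately show ?thesis by (simp add: compact_Int_closed)
  qed
  moreover have "S \<noteq> {}"
  proof -
    obtain i j :: 'n where ij: "i \<noteq> j"
      using card by (metis card_2_iff' card_le_Suc0_iff_eq finite_class.finite_UNIV UNIV_I not_less_eq_eq numeral_2_eq_2)
    \<comment> \<open>The normalised difference of two unit vectors lies in \<open>S\<close>; this
      is where the dimension must be at least 2.\<close>
    define z :: "real^'n" where "z = axis i 1 - axis j 1"
    have "z $ i = 1" using ij by (simp add: z_def axis_def)
    then have "z \<noteq> 0" by auto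
    moreover have "z \<bullet> 1 = 0" by (simp add: z_def inner_diff_left inner_axis')
    ultimately have "(1 / norm z) *\<^sub>R z \<in> S" by (simp add: S_def)
    then show ?thesis by blast
  qed
  moreover have "continuous_on S (\<lambda>x. x \<bullet> (A *v x))"
    by (intro continuous_intros matrix_vector_mult_linear_continuous_on)
  ultimately obtain x where x: "x \<in> S" "\<And>y. y \<in> S \<Longrightarrow> x \<bullet> (A *v x) \<le> y \<bullet> (A *v y)"
    using continuous_attains_inf[of S] by metis
  define \<mu> where "\<mu> = x \<bullet> (A *v x)"
  have min: "\<mu> * (y \<bullet> y) \<le> y \<bullet> (A *v y)" if y: "y \<bullet> 1 = 0" for y
  proof (cases "y = 0")
    case False
    then have "(1 / norm y) *\<^sub>R y \<in> S" using y by (simp add: S_def)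
    from x(2)[OF this] have "\<mu> \<le> (1 / norm y) * ((1 / norm y) * (y \<bullet> (A *v y)))"
      by (simp add: \<mu>_def matrix_vector_mult_scaleR)
    then show ?thesis using False
      by (simp add: field_simps power2_norm_eq_inner[symmetric] power2_eq_square)
  qed simp
  have xx: "x \<bullet> x = 1" "x \<bullet> 1 = 0" using x(1) by (auto simp: S_def norm_eq_1)
  have "A *v x = \<mu> *\<^sub>R x"
    by (rule min_on_subspace_imp_eigenvector[OF sym one min xx(2)]) (simp_all add: \<mu>_def xx)
  moreover have "x \<noteq> 0" using xx(1) by auto
  ultimately show ?thesis using that[of \<mu> x] min xx(2) by (simp add: eigenvector_def)
qed

text \<open>As the kernel is spanned by \<open>1\<close>, the value 0 has multiplicity one and heads
  the sorted list. Index 1 therefore holds the least nonzero eigenvalue. It equals the Rayleigh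
  minimum on the complement of \<open>1\<close>, because eigenvectors for nonzero eigenvalues are
  orthogonal to \<open>1\<close>.\<close>

lemma second_eigenvalue:
  fixes A :: "real^'n^'n"
  assumes sym: "\<And>x y. x \<bullet> (A *v y) = (A *v x) \<bullet> y"
    and psd: "\<And>x. 0 \<le> x \<bullet> (A *v x)"
    and ker: "\<And>x. A *v x = 0 \<longleftrightarrow> x \<in> span {1}"
    and card: "2 \<le> CARD('n)"
  defines "\<alpha> \<equiv> sorted_list_of_multiset (eigenvalue_mset A) ! 1"
  shows "0 < \<alpha>" "\<exists>x. eigenvector A \<alpha> x"
    "\<And>x. x \<bullet> 1 = 0 \<Longrightarrow> \<alpha> * (x \<bullet> x) \<le> x \<bullet> (A *v x)"
proof -
  have one: "A *v 1 = 0" by (simp add: ker span_base)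
  have v1: "(1 :: real^'n) \<noteq> 0" by (simp add: vec_eq_iff)
  obtain \<mu> x where \<mu>: "eigenvector A \<mu> x" "x \<bullet> 1 = 0"
    "\<And>y. y \<bullet> 1 = 0 \<Longrightarrow> \<mu> * (y \<bullet> y) \<le> y \<bullet> (A *v y)"
    using eigenvector_min_on_subspace[OF sym one card] by blast
  have x0: "x \<noteq> 0" "A *v x = \<mu> *\<^sub>R x" using \<mu>(1) by (auto simp: eigenvector_def)
  have "\<mu> \<noteq> 0"
  proof
    assume "\<mu> = 0"
    then have "x \<in> span {1}" using x0 by (simp flip: ker)
    then obtain k where "x = k *\<^sub>R 1" by (auto simp: span_singleton)
    then have "x \<bullet> x = k * (x \<bullet> 1)" by (metis inner_scaleR_right)
    then show False using \<mu>(2) x0 by simp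
  qed
  moreover have "0 \<le> \<mu>"
  proof -
    have "0 \<le> \<mu> * (x \<bullet> x)" using psd[of x] x0 by simp
    then show ?thesis using x0(1) by (metis inner_gt_zero_iff zero_le_mult_iff not_less)
  qed
  ultimately have \<mu>pos: "0 < \<mu>" by simp
  have ge: "\<mu> \<le> \<nu>" if \<nu>: "eigenvalue A \<nu>" "\<nu> \<noteq> 0" for \<nu>
  proof -
    obtain y where y: "y \<noteq> 0" "A *v y = \<nu> *\<^sub>R y" using \<nu> by (auto simp: eigenvalue_def eigenvector_def)
    have "\<nu> * (y \<bullet> 1) = 0" using sym[of y "1"] one y by simp
    then have "y \<bullet> 1 = 0" using that by simp
    from \<mu>(3)[OF this] have "\<mu> * (y \<bullet> y) \<le> \<nu> * (y \<bullet> y)" using y by simp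
    then show ?thesis using y(1) by simp
  qed
  define Ev where "Ev = {\<nu>. eigenvalue A \<nu>}"
  have fin: "finite Ev" unfolding Ev_def by (rule finite_eigenvalues_symmetric[OF sym])
  define M where "M \<nu> = replicate_mset (dim {x. A *v x = \<nu> *\<^sub>R x}) \<nu>" for \<nu>
  have "0 \<in> Ev" using one v1 by (auto simp: Ev_def eigenvalue_def eigenvector_def intro!: exI[of _ "1"])
  then have "eigenvalue_mset A = M 0 + (\<Sum>\<nu>\<in>Ev - {0}. M \<nu>)"
    unfolding eigenvalue_mset_def Ev_def[symmetric] M_def[symmetric]
    using fin by (simp add: sum.remove)
  moreover have "M 0 = {#0#}"
  proof -
    have "{x. A *v x = 0 *\<^sub>R x} = span {1}" using ker by auto
    moreover have "dim (span {1 :: real^'n}) = 1" using v1 by (simp add: dim_span)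
    ultimately show ?thesis by (simp add: M_def)
  qed
  moreover define N where "N = (\<Sum>\<nu>\<in>Ev - {0}. M \<nu>)"
  ultimately have ev: "eigenvalue_mset A = add_mset 0 N" by simp
  have Nset: "set_mset N = (\<Union>\<nu>\<in>Ev - {0}. set_mset (M \<nu>))"
    unfolding N_def using fin by (simp add: set_mset_sum)
  have Nge: "\<mu> \<le> \<nu>" if "\<nu> \<in># N" for \<nu>
    using that ge unfolding Nset by (auto simp: M_def Ev_def split: if_splits)
  have "dim {x. A *v x = \<mu> *\<^sub>R x} \<noteq> 0"
    using x0 by (auto simp: dim_eq_0)
  moreover have "\<mu> \<in> Ev - {0}" using \<mu>(1) \<mu>pos by (auto simp: Ev_def eigenvalue_def)
  ultimately have \<mu>N: "\<mu> \<in># N" unfolding Nset by (auto simp: M_def intro!: bexI[of _ \<mu>])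
  define xs where "xs = sorted_list_of_multiset N"
  have xs: "sorted xs" "set xs = set_mset N" by (auto simp: xs_def)
  have "sorted_list_of_multiset (eigenvalue_mset A) = 0 # xs"
  proof -
    have "\<forall>y\<in>set xs. 0 \<le> y" using Nge \<mu>pos xs(2) by force
    then have "insort 0 xs = 0 # xs" by (cases xs) auto
    then show ?thesis by (simp add: ev xs_def)
  qed
  then have "\<alpha> = xs ! 0" by (simp add: \<alpha>_def)
  moreover have "xs \<noteq> []" using \<mu>N xs(2) by auto
  ultimately have "\<alpha> \<in># N" "\<alpha> \<le> \<mu>" using xs \<mu>N
    by (metis length_greater_0_conv nth_mem) (metis \<open>\<alpha> = xs ! 0\<close> \<open>xs \<noteq> []\<close> \<mu>N in_set_conv_nth less_eq_nat.simps(1) sorted_nth_mono xs)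
  then have "\<alpha> = \<mu>" using Nge by force
  then show "0 < \<alpha>" "\<exists>x. eigenvector A \<alpha> x"
    "\<And>x. x \<bullet> 1 = 0 \<Longrightarrow> \<alpha> * (x \<bullet> x) \<le> x \<bullet> (A *v x)"
    using \<mu> \<mu>pos by auto
qed

section \<open>Trees and parent functions\<close>

definition graph_path :: "'a rel \<Rightarrow> 'a list \<Rightarrow> bool" where
  "graph_path A ws \<longleftrightarrow> distinct ws \<and> successively (\<lambda>x y. (x, y) \<in> A) ws"

text \<open>The vertex set is the whole type, so connectedness reads
  \<open>A\<^sup>* = UNIV\<close>. A cycle is encoded as a path of at least three vertices whose
  ends are adjacent.\<close>

definition tree_arcs :: "'a rel \<Rightarrow> bool" where
  "tree_arcs A \<longleftrightarrow> sym A \<and> irrefl A \<and> A\<^sup>* = UNIV \<and>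
     (\<forall>ws. graph_path A ws \<longrightarrow> 3 \<le> length ws \<longrightarrow> (last ws, hd ws) \<notin> A)"

text \<open>The root is its own parent, so \<open>p\<close> is total and every difference
  \<open>f x - f (p x)\<close> vanishes at the root.\<close>

definition rooted :: "('a \<Rightarrow> 'a) \<Rightarrow> 'a \<Rightarrow> bool" where
  "rooted p u \<longleftrightarrow> p u = u \<and> (\<forall>x. \<exists>k. (p ^^ k) x = u)"

definition parent_arcs :: "('a \<Rightarrow> 'a) \<Rightarrow> 'a rel" where
  "parent_arcs p = {(x, y). x \<noteq> y \<and> (p x = y \<or> p y = x)}"

lemma graph_path_Nil [simp]: "graph_path A []"
  and graph_path_single [simp]: "graph_path A [x]"
  by (simp_all add: graph_path_def)

lemma graph_path_Cons2 [simp]: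
  "graph_path A (x # y # ws) \<longleftrightarrow> x \<noteq> y \<and> x \<notin> set ws \<and> (x, y) \<in> A \<and> graph_path A (y # ws)"
  by (auto simp: graph_path_def)

lemma graph_path_append:
  "graph_path A (xs @ ys) \<longleftrightarrow> graph_path A xs \<and> graph_path A ys \<and> set xs \<inter> set ys = {} \<and>
     (xs \<noteq> [] \<and> ys \<noteq> [] \<longrightarrow> (last xs, hd ys) \<in> A)"
  by (auto simp: graph_path_def successively_append_iff)

lemma graph_path_mono: "graph_path A ws \<Longrightarrow> A \<subseteq> B \<Longrightarrow> graph_path B ws"
  unfolding graph_path_def by (auto elim!: successively_mono)

lemma graph_path_rev:
  assumes "sym A" shows "graph_path A (rev ws) \<longleftrightarrow> graph_path A ws"
proof -
  have "(\<lambda>x y. (y, x) \<in> A) = (\<lambda>x y. (x, y) \<in> A)"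
    using assms by (auto simp: fun_eq_iff dest: symD)
  then show ?thesis by (simp add: graph_path_def cong del: successively_cong)
qed

lemma rtrancl_imp_graph_path:
  assumes "(x, y) \<in> R\<^sup>*"
  shows "\<exists>ws. graph_path R ws \<and> ws \<noteq> [] \<and> hd ws = x \<and> last ws = y"
  using assms
proof (induction rule: rtrancl_induct)
  case base
  show ?case by (intro exI[of _ "[x]"]) simp
next
  case (step y z)
  then obtain ws where ws: "graph_path R ws" "ws \<noteq> []" "hd ws = x" "last ws = y" by blast
  show ?case
  proof (cases "z \<in> set ws")
    \<comment> \<open>A revisited vertex: the path is cut at its earlier occurrence and stays
      simple.\<close>
    case True
    then obtain as bs where eq: "ws = (as @ [z]) @ bs" by (metis append.assoc append_Cons append_Nil split_list)
    then have "graph_path R (as @ [z])" using ws(1) graph_path_append by metis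
    moreover have "hd (as @ [z]) = x" using ws(3) eq by (cases as) auto
    ultimately show ?thesis by (intro exI[of _ "as @ [z]"]) simp
  next
    case False
    then have "graph_path R (ws @ [z])" using ws step.hyps by (simp add: graph_path_append)
    moreover have "hd (ws @ [z]) = x" using ws by simp
    ultimately show ?thesis by (intro exI[of _ "ws @ [z]"]) simp
  qed
qed

lemma successively_rtrancl:
  assumes "successively (\<lambda>x y. (x, y) \<in> R) ws" "ws \<noteq> []"
  shows "(hd ws, last ws) \<in> R\<^sup>*"
  using assms
proof (induction ws rule: induct_list012)
  case (3 x y zs)
  then have "(x, y) \<in> R" "(y, last (y # zs)) \<in> R\<^sup>*" by auto
  then show ?case by (simp add: converse_rtrancl_into_rtrancl)
qed auto

text \<open>A longer path with adjacent ends would close to a cycle, and a single vertex would carry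
  a loop. Later arguments about chords of paths use acyclicity in this form.\<close>

lemma tree_arcs_length_2:
  assumes "tree_arcs A" "graph_path A ws" "ws \<noteq> []" "(hd ws, last ws) \<in> A"
  shows "length ws = 2"
proof -
  have "(last ws, hd ws) \<in> A" using assms by (auto simp: tree_arcs_def dest: symD)
  then have "length ws < 3" using assms by (auto simp: tree_arcs_def not_less)
  moreover have "length ws \<noteq> 1"
  proof
    assume "length ws = 1"
    then obtain a where "ws = [a]" by (auto simp: length_Suc_conv)
    then show False using assms by (auto simp: tree_arcs_def irrefl_def)
  qed
  ultimately show ?thesis using assms(3) by (cases ws) (auto simp: less_Suc_eq numeral_3_eq_3)
qed

text \<open>The parent of \<open>x\<close> is the neighbour from which \<open>u\<close> can be
  reached without touching \<open>x\<close>. Two such neighbours would be joined by a path avoiding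
  \<open>x\<close>, closing a cycle through \<open>x\<close>.\<close>

lemma tree_arcs_imp_rooted:
  assumes A: "tree_arcs A"
  obtains p where "rooted p u" "A = parent_arcs p"
proof -
  have symA: "sym A" and irr: "\<And>x. (x, x) \<notin> A" and conn: "A\<^sup>* = UNIV"
    using A by (auto simp: tree_arcs_def irrefl_def)
  define B where "B x = {(a, b) \<in> A. a \<noteq> x \<and> b \<noteq> x}" for x
  define p where "p x = (if x = u then u else (THE y. (x, y) \<in> A \<and> (y, u) \<in> (B x)\<^sup>*))" for x
  have symB: "sym (B x)" for x using symA by (auto simp: B_def sym_def)
  \<comment> \<open>The condition on the head matters for lists of one vertex, where no arc is
    checked.\<close>
  have avoid: "x \<notin> set ws" if "successively (\<lambda>a b. (a, b) \<in> B x) ws" "ws \<noteq> []" "hd ws \<noteq> x" for x ws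
    using that by (induction ws rule: induct_list012) (auto simp: B_def)
  have uniq: "y = z" if xy: "(x, y) \<in> A" "(x, z) \<in> A" and yu: "(y, u) \<in> (B x)\<^sup>*" "(z, u) \<in> (B x)\<^sup>*" for x y z
  proof (rule ccontr)
    assume "y \<noteq> z"
    have "(u, z) \<in> (B x)\<^sup>*" using yu(2) symB by (metis sym_rtrancl symD)
    then have "(y, z) \<in> (B x)\<^sup>*" using yu(1) by (meson rtrancl_trans)
    then obtain ws where ws: "graph_path (B x) ws" "ws \<noteq> []" "hd ws = y" "last ws = z"
      using rtrancl_imp_graph_path by metis
    have "x \<notin> set ws" using avoid[of x ws] ws xy irr by (auto simp: graph_path_def)
    moreover have "graph_path A ws" using graph_path_mono[OF ws(1)] by (auto simp: B_def)
    ultimately have "graph_path A (x # ws)" using ws(2,3) xy by (cases ws) auto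
    moreover obtain v w ws' where "ws = v # w # ws'" using ws \<open>y \<noteq> z\<close>
      by (metis last.simps list.collapse list.sel(1))
    ultimately show False using A xy(2) ws(4) symD[OF symA]
      unfolding tree_arcs_def by (metis One_nat_def Suc_eq_plus1 last_ConsR le_add2 length_Cons
        list.distinct(1) list.sel(1) numeral_3_eq_3 Suc_le_mono le0)
  qed
  have pI: "p x = y" if "x \<noteq> u" "(x, y) \<in> A" "(y, u) \<in> (B x)\<^sup>*" for x y
    using that uniq unfolding p_def by auto
  have avoidB: "(hd ws, last ws) \<in> (B x)\<^sup>*" if "graph_path A ws" "ws \<noteq> []" "x \<notin> set ws" for x ws
  proof (rule successively_rtrancl)
    show "successively (\<lambda>a b. (a, b) \<in> B x) ws"
      using that unfolding graph_path_def by (auto simp: B_def elim!: successively_mono)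
  qed (fact that)
  have pI': "p x = y" if "graph_path A (x # y # ws)" "last (y # ws) = u" for x y ws
  proof (rule pI)
    show "x \<noteq> u" using that by (metis last_in_set list.distinct(1) list.set_intros(1) set_ConsD graph_path_Cons2)
    show "(x, y) \<in> A" using that by simp
    show "(y, u) \<in> (B x)\<^sup>*" using avoidB[of "y # ws" x] that by auto
  qed
  have path: "\<exists>ws. graph_path A (x # ws) \<and> last (x # ws) = u" for x
  proof -
    have "(x, u) \<in> A\<^sup>*" using conn by simp
    from rtrancl_imp_graph_path[OF this] show ?thesis by (metis list.collapse)
  qed
  have iter: "\<exists>k. (p ^^ k) (hd ws) = u" if "graph_path A ws" "ws \<noteq> []" "last ws = u" for ws
    using that
  proof (induction ws rule: induct_list012)
    case (2 x)
    then show ?case by (intro exI[of _ 0]) simp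
  next
    case (3 x y zs)
    then obtain k where "(p ^^ k) y = u" by auto
    moreover have "p x = y" using 3 by (intro pI'[of x y zs]) auto
    ultimately show ?case by (intro exI[of _ "Suc k"]) (simp add: funpow_swap1)
  qed simp
  have "rooted p u"
    unfolding rooted_def using path iter by (metis list.distinct(1) list.sel(1) p_def)
  moreover have "A = parent_arcs p"
  proof (intro set_eqI iffI; clarify)
    fix x y assume xy: "(x, y) \<in> A"
    then have yx: "(y, x) \<in> A" using symA by (auto dest: symD)
    have "x \<noteq> y" using xy irr by auto
    moreover have "p x = y \<or> p y = x"
    proof (cases "x = u \<or> y = u")
      case True
      then show ?thesis using pI[of x y] pI[of y x] xy yx \<open>x \<noteq> y\<close> by auto
    next
      case False
      \<comment> \<open>A path from \<open>x\<close> to \<open>u\<close> decides the orientation of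
        the edge: if it runs through \<open>y\<close>, its final part shows \<open>p x = y\<close>;
        if it avoids \<open>y\<close>, it shows \<open>p y = x\<close>.\<close>
      obtain ws where ws: "graph_path A (x # ws)" "last (x # ws) = u" using path by blast
      show ?thesis
      proof (cases "y \<in> set ws")
        case True
        then obtain as bs where eq: "ws = as @ y # bs" by (meson split_list)
        have "graph_path A ((x # as) @ (y # bs))" using ws eq by simp
        then have "graph_path A (y # bs)" "x \<notin> set (y # bs)"
          unfolding graph_path_append by auto
        then have "(hd (y # bs), last (y # bs)) \<in> (B x)\<^sup>*" by (intro avoidB) auto
        then show ?thesis using pI[of x y] xy ws(2) eq False by simp
      next
        case nin: False
        have "(hd (x # ws), last (x # ws)) \<in> (B y)\<^sup>*" using ws nin \<open>x \<noteq> y\<close> by (intro avoidB) auto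
        then show ?thesis using pI[of y x] yx ws(2) False by simp
      qed
    qed
    ultimately show "(x, y) \<in> parent_arcs p" by (simp add: parent_arcs_def)
  next
    have *: "(x, p x) \<in> A" if "p x \<noteq> x" for x
    proof -
      obtain ws where ws: "graph_path A (x # ws)" "last (x # ws) = u" using path by blast
      have "x \<noteq> u" using that by (auto simp: p_def)
      then obtain y zs where "ws = y # zs" using ws by (cases ws) auto
      then show ?thesis using pI'[of x y zs] ws by auto
    qed
    fix x y assume "(x, y) \<in> parent_arcs p"
    then show "(x, y) \<in> A" using *[of x] *[of y] symA by (auto simp: parent_arcs_def dest: symD)
  qed
  ultimately show ?thesis using that by blast
qed

text \<open>The number of steps to the root drops with every parent step. This measure stands in for
  induction on the tree.\<close>

lemma rooted_depth:
  assumes "rooted p u"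
  obtains d :: "'a \<Rightarrow> nat" where "\<And>x. x \<noteq> u \<Longrightarrow> d (p x) < d x"
proof -
  define d where "d x = (LEAST k. (p ^^ k) x = u)" for x
  have "d (p x) < d x" if "x \<noteq> u" for x
  proof -
    have "(p ^^ d x) x = u"
      using assms unfolding d_def rooted_def by (metis (mono_tags, lifting) LeastI_ex)
    moreover from this that obtain k where "d x = Suc k" by (cases "d x") auto
    ultimately have "(p ^^ k) (p x) = u" by (simp add: funpow_swap1)
    then have "d (p x) \<le> k" unfolding d_def by (rule Least_le)
    then show ?thesis using \<open>d x = Suc k\<close> by simp
  qed
  then show ?thesis by (rule that)
qed

text \<open>Connectedness runs through the root. On a cycle, a vertex of maximal depth would have
  its parent as both of its cycle neighbours, but these are distinct when the cycle has at least
  three vertices.\<close>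

lemma rooted_imp_tree_arcs:
  assumes "rooted p u"
  shows "tree_arcs (parent_arcs p)"
proof -
  have symP: "sym (parent_arcs p)" by (auto simp: sym_def parent_arcs_def)
  have toroot: "(p ^^ k) x = u \<Longrightarrow> (x, u) \<in> (parent_arcs p)\<^sup>*" for k x
  proof (induction k arbitrary: x)
    case (Suc k)
    then have "(p x, u) \<in> (parent_arcs p)\<^sup>*" by (simp add: funpow_swap1)
    moreover have "x = p x \<or> (x, p x) \<in> parent_arcs p" by (auto simp: parent_arcs_def)
    ultimately show ?case by (metis converse_rtrancl_into_rtrancl)
  qed auto
  have "(x, y) \<in> (parent_arcs p)\<^sup>*" for x y
  proof -
    have "(x, u) \<in> (parent_arcs p)\<^sup>*" "(y, u) \<in> (parent_arcs p)\<^sup>*"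
      using toroot assms unfolding rooted_def by metis+
    then show ?thesis using symP by (meson rtrancl_trans sym_rtrancl symD)
  qed
  moreover have "(last ws, hd ws) \<notin> parent_arcs p" if ws: "graph_path (parent_arcs p) ws" "3 \<le> length ws" for ws
  proof
    assume close: "(last ws, hd ws) \<in> parent_arcs p"
    obtain d where d: "\<And>x. x \<noteq> u \<Longrightarrow> d (p x) < (d x :: nat)" using rooted_depth[OF assms] by blast
    define n where "n = length ws"
    have n: "3 \<le> n" "ws \<noteq> []" using ws by (auto simp: n_def)
    have suc: "(ws ! i, ws ! ((i + 1) mod n)) \<in> parent_arcs p" if "i < n" for i
    proof (cases "i + 1 < n")
      case True
      then show ?thesis using ws(1) by (auto simp: graph_path_def n_def successively_conv_nth)
    next
      case False
      then have "i + 1 = n" using that by simp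
      then have "i = n - 1" "(i + 1) mod n = 0" by simp_all
      then show ?thesis using close n by (simp add: last_conv_nth hd_conv_nth n_def)
    qed
    define D where "D = (\<lambda>i. d (ws ! i)) ` {..<n}"
    have "0 \<in> {..<n}" using n by auto
    then have D: "finite D" "D \<noteq> {}" unfolding D_def by auto
    from Max_in[OF D] obtain m where m: "m < n" "d (ws ! m) = Max D" unfolding D_def by auto
    have max: "d (ws ! i) \<le> d (ws ! m)" if "i < n" for i
      using that D unfolding m(2) by (intro Max_ge) (auto simp: D_def)
    have par: "p (ws ! m) = y" if "(ws ! m, y) \<in> parent_arcs p" "d y \<le> d (ws ! m)" for y
    proof (rule ccontr)
      assume "p (ws ! m) \<noteq> y"
      then have "p y = ws ! m" "y \<noteq> ws ! m" using that by (auto simp: parent_arcs_def)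
      then have "y \<noteq> u" using assms by (auto simp: rooted_def)
      from d[OF this] show False using \<open>p y = ws ! m\<close> that by simp
    qed
    \<comment> \<open>The cyclic predecessor of \<open>m\<close>; it differs from the cyclic
      successor because \<open>n\<close> is at least 3.\<close>
    define m' where "m' = (if m = 0 then n - 1 else m - 1)"
    have next_m: "(m + 1) mod n = (if m + 1 = n then 0 else m + 1)" using m(1) by auto
    have "m' < n" using m(1) by (auto simp: m'_def)
    moreover have "(m' + 1) mod n = m" using m(1) by (auto simp: m'_def)
    moreover have "m' \<noteq> (m + 1) mod n" unfolding next_m m'_def using n(1) by (auto split: if_splits)
    moreover have "(m + 1) mod n < n" unfolding next_m using m(1) by auto
    ultimately have m': "m' < n" "(m' + 1) mod n = m" "m' \<noteq> (m + 1) mod n" "(m + 1) mod n < n"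
      by blast+
    have "p (ws ! m) = ws ! ((m + 1) mod n)" using suc[OF m(1)] max[OF m'(4)] by (rule par)
    moreover have "(ws ! m, ws ! m') \<in> parent_arcs p" using suc[OF m'(1)] m'(2) symP by (auto dest: symD)
    then have "p (ws ! m) = ws ! m'" using max[OF m'(1)] by (rule par)
    ultimately have "ws ! m' = ws ! ((m + 1) mod n)" by simp
    then show False using m' ws(1) nth_eq_iff_index_eq[of ws m' "(m + 1) mod n"]
      by (simp add: graph_path_def n_def)
  qed
  ultimately show ?thesis using symP unfolding tree_arcs_def
    by (auto simp: irrefl_def parent_arcs_def)
qed

text \<open>The root has no parent but itself, so the first step goes to a child; a later step
  upwards would return to the vertex just left.\<close>

lemma graph_path_from_root:
  assumes r: "rooted p u" and ws: "graph_path (parent_arcs p) ws" "hd ws = u"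
  shows "successively (\<lambda>x y. p y = x) ws"
  unfolding successively_conv_nth
proof (intro allI)
  have adj: "(ws ! i, ws ! Suc i) \<in> parent_arcs p" if "Suc i < length ws" for i
    using that ws by (auto simp: graph_path_def successively_conv_nth)
  have dist: "distinct ws" using ws by (simp add: graph_path_def)
  fix i show "Suc i < length ws \<longrightarrow> p (ws ! Suc i) = ws ! i"
  proof (induction i)
    case 0
    show ?case
    proof
      assume "Suc 0 < length ws"
      then have "(u, ws ! Suc 0) \<in> parent_arcs p" using adj[of 0] ws(2) by (cases ws) auto
      then show "p (ws ! Suc 0) = ws ! 0" using \<open>Suc 0 < length ws\<close> r ws(2)
        by (cases ws) (auto simp: parent_arcs_def rooted_def)
    qed
  next
    case (Suc i)
    show ?case
    proof
      assume len: "Suc (Suc i) < length ws"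
      then have "p (ws ! Suc i) = ws ! i" using Suc by simp
      moreover have "ws ! i \<noteq> ws ! Suc (Suc i)" using len dist by (simp add: nth_eq_iff_index_eq)
      ultimately show "p (ws ! Suc (Suc i)) = ws ! Suc i" using adj[OF len] by (auto simp: parent_arcs_def)
    qed
  qed
qed

lemma graph_path_between:
  assumes "tree_arcs A"
  obtains ws where "graph_path A ws" "ws \<noteq> []" "hd ws = x" "last ws = y"
  using rtrancl_imp_graph_path[of x y A] assms by (auto simp: tree_arcs_def)

section \<open>The Laplacian form of a tree\<close>

lemma vertex_degree_conv: "vertex_degree G v = card (parcs G `` {v})"
proof -
  have "out_arcs (with_proj G) v = Pair v ` (parcs G `` {v})"
    by (auto simp: out_arcs_def)
  then show ?thesis by (simp add: vertex_degree_def out_degree_def card_image inj_on_def)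
qed

lemma pawalk_verts_neq_Nil [simp]: "pawalk_verts u p \<noteq> []"
  by (cases p) auto

lemma pcas_imp_successively:
  assumes "pcas u p v" "set p \<subseteq> A"
  shows "hd (pawalk_verts u p) = u \<and> last (pawalk_verts u p) = v \<and>
    successively (\<lambda>x y. (x, y) \<in> A) (pawalk_verts u p) \<and> length (pawalk_verts u p) = Suc (length p)"
  using assms by (induction p arbitrary: u) (auto simp: successively_Cons)

lemma successively_imp_pcas:
  assumes "successively (\<lambda>x y. (x, y) \<in> A) (u # ws)"
  shows "\<exists>p. pcas u p (last (u # ws)) \<and> set p \<subseteq> A \<and> pawalk_verts u p = u # ws"
  using assms
proof (induction ws arbitrary: u)
  case Nil
  show ?case by (intro exI[of _ "[]"]) simp
next
  case (Cons w ws)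
  then obtain p where "pcas w p (last (w # ws))" "set p \<subseteq> A" "pawalk_verts w p = w # ws" by auto
  then show ?case using Cons.prems by (intro exI[of _ "(u, w) # p"]) auto
qed

lemma rtrancl_on_UNIV: "rtrancl_on UNIV R = R\<^sup>*"
proof (intro set_eqI iffI; clarify)
  fix x y assume "(x, y) \<in> rtrancl_on UNIV R"
  then show "(x, y) \<in> R\<^sup>*" by (induction rule: rtrancl_on_induct) auto
next
  fix x y assume "(x, y) \<in> R\<^sup>*"
  then show "(x, y) \<in> rtrancl_on UNIV R"
    by (induction rule: rtrancl_induct) (auto intro: rtrancl_on_into_rtrancl_on)
qed

text \<open>A closed walk lists its start twice; dropping the first copy turns a cycle with
  \<open>length p\<close> arcs into a path with as many vertices whose ends are adjacent. This lets
  the rest of the argument work with \<open>tree_arcs\<close>.\<close>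

lemma is_tree_iff_tree_arcs:
  fixes G :: "'v::finite pair_pre_digraph"
  assumes "pverts G = UNIV"
  shows "is_tree G \<longleftrightarrow> tree_arcs (parcs G)"
proof -
  have pg: "pair_graph G \<longleftrightarrow> sym (parcs G) \<and> irrefl (parcs G)"
  proof
    assume "pair_graph G"
    then interpret pair_graph G .
    show "sym (parcs G) \<and> irrefl (parcs G)"
      using sym_arcs no_loops' by (auto simp: symmetric_def irrefl_def)
  next
    assume "sym (parcs G) \<and> irrefl (parcs G)"
    then show "pair_graph G"
      by unfold_locales (auto simp: assms symmetric_def irrefl_def)
  qed
  have conn: "connected (with_proj G) \<longleftrightarrow> (parcs G)\<^sup>* = UNIV" if "sym (parcs G)"
  proof -
    have "(parcs G)\<^sup>s = parcs G" using that by (auto simp: symcl_def dest: symD)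
    then show ?thesis by (auto simp: connected_conv assms rtrancl_on_UNIV)
  qed
  have cyc: "(\<exists>p. pre_digraph.cycle (with_proj G) p \<and> 3 \<le> length p) \<longleftrightarrow>
     (\<exists>ws. graph_path (parcs G) ws \<and> 3 \<le> length ws \<and> (last ws, hd ws) \<in> parcs G)" (is "?L = ?R")
  proof
    assume ?L
    then obtain p u where p: "set p \<subseteq> parcs G" "pcas u p u" "distinct (tl (pawalk_verts u p))" "3 \<le> length p"
      by (auto simp: pre_digraph.cycle_def pre_digraph.awalk_def awalk_verts_with_proj_eq cas_with_proj_eq)
    note * = pcas_imp_successively[OF p(2,1)]
    then obtain ws where ws: "pawalk_verts u p = u # ws" by (metis list.collapse pawalk_verts_neq_Nil)
    then have "ws \<noteq> []" "length ws = length p" "last ws = u"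
      using * p(4) by (auto split: if_splits)
    then show ?R using p * ws
      by (intro exI[of _ ws]) (auto simp: graph_path_def successively_Cons)
  next
    assume ?R
    then obtain ws where ws: "graph_path (parcs G) ws" "3 \<le> length ws" "(last ws, hd ws) \<in> parcs G" by blast
    then have "successively (\<lambda>x y. (x, y) \<in> parcs G) (last ws # ws)"
      by (auto simp: graph_path_def successively_Cons)
    from successively_imp_pcas[OF this] ws(2)
    obtain p where p: "pcas (last ws) p (last ws)" "set p \<subseteq> parcs G" "pawalk_verts (last ws) p = last ws # ws"
      by (auto split: if_splits)
    have "length p = length ws" using pcas_imp_successively[OF p(1,2)] p(3) by simp
    then show ?L using p ws
      by (intro exI[of _ p])
        (auto simp: pre_digraph.cycle_def pre_digraph.awalk_def awalk_verts_with_proj_eq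
          cas_with_proj_eq assms graph_path_def intro!: exI[of _ "last ws"])
  qed
  show ?thesis unfolding is_tree_def pg cyc tree_arcs_def using conn by auto
qed

section \<open>The Laplacian as a Dirichlet form\<close>

lemma laplacian_mult:
  "(laplacian G *v f) $ x = (\<Sum>y\<in>parcs G `` {x}. f $ x - f $ y)"
proof -
  have "(laplacian G *v f) $ x =
      (\<Sum>y\<in>UNIV. (if y = x then real (vertex_degree G x) * f $ y else 0) - (if y \<in> parcs G `` {x} then f $ y else 0))"
    unfolding laplacian_def degree_matrix_def adjacency_matrix_def matrix_vector_mult_def
    by (auto simp: algebra_simps intro!: sum.cong)
  also have "\<dots> = real (vertex_degree G x) * f $ x - (\<Sum>y\<in>parcs G `` {x}. f $ y)"
    by (simp add: sum_subtractf sum.delta sum.If_cases Image_singleton)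
  finally show ?thesis by (simp add: sum_subtractf vertex_degree_conv)
qed

text \<open>Each edge joins exactly one non-root vertex to its parent, and the upward arcs are
  disjoint from the downward ones since depth cannot drop in both directions.\<close>

lemma sum_parent_arcs:
  fixes h :: "'v::finite \<times> 'v \<Rightarrow> real"
  assumes "rooted p u"
  shows "sum h (parent_arcs p) = (\<Sum>x\<in>-{u}. h (x, p x) + h (p x, x))"
proof -
  obtain d where d: "\<And>x. x \<noteq> u \<Longrightarrow> d (p x) < (d x :: nat)" using rooted_depth[OF assms] by blast
  have pu: "p u = u" using assms by (simp add: rooted_def)
  have px: "p x \<noteq> x" if "x \<noteq> u" for x using d[OF that] by auto
  define Up where "Up = (\<lambda>x. (x, p x)) ` (-{u})"
  define Dn where "Dn = (\<lambda>x. (p x, x)) ` (-{u})"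
  have "parent_arcs p = Up \<union> Dn"
    using pu px by (auto simp: parent_arcs_def Up_def Dn_def image_iff) (metis px)+
  moreover have "Up \<inter> Dn = {}"
  proof (rule ccontr)
    assume "Up \<inter> Dn \<noteq> {}"
    then obtain x where "x \<noteq> u" "p x \<noteq> u" "p (p x) = x" by (auto simp: Up_def Dn_def)
    then show False using d[of x] d[of "p x"] by simp
  qed
  moreover have "sum h Up = (\<Sum>x\<in>-{u}. h (x, p x))" "sum h Dn = (\<Sum>x\<in>-{u}. h (p x, x))"
    unfolding Up_def Dn_def by (subst sum.reindex; auto simp: inj_on_def)+
  ultimately show ?thesis by (simp add: sum.union_disjoint sum.distrib)
qed

text \<open>Each non-root vertex stands for the edge to its parent, and the root contributes 0. The
  tree enters only through \<open>p\<close>, so changing parents and test vector together can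
  preserve the energy.\<close>

lemma laplacian_form_parent:
  fixes G :: "'v::finite pair_pre_digraph"
  assumes "rooted p u" "parcs G = parent_arcs p"
  shows "g \<bullet> (laplacian G *v f) = (\<Sum>x\<in>UNIV. (g $ x - g $ (p x)) * (f $ x - f $ (p x)))"
proof -
  have "g \<bullet> (laplacian G *v f) = (\<Sum>x\<in>UNIV. \<Sum>y\<in>parcs G `` {x}. g $ x * (f $ x - f $ y))"
    by (simp add: inner_vec_def laplacian_mult sum_distrib_left)
  also have "\<dots> = (\<Sum>(x, y)\<in>parcs G. g $ x * (f $ x - f $ y))"
    by (subst sum.Sigma) (auto intro!: sum.cong)
  also have "\<dots> = (\<Sum>x\<in>-{u}. (g $ x - g $ (p x)) * (f $ x - f $ (p x)))"
    unfolding assms(2) by (subst sum_parent_arcs[OF assms(1)]) (simp add: algebra_simps)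
  also have "\<dots> = (\<Sum>x\<in>UNIV. (g $ x - g $ (p x)) * (f $ x - f $ (p x)))"
    using assms(1) by (intro sum.mono_neutral_left) (auto simp: rooted_def)
  finally show ?thesis .
qed

lemma laplacian_form_sym:
  fixes G :: "'v::finite pair_pre_digraph"
  assumes "tree_arcs (parcs G)"
  shows "x \<bullet> (laplacian G *v y) = (laplacian G *v x) \<bullet> y"
proof -
  obtain p where p: "rooted p undefined" "parcs G = parent_arcs p"
    using tree_arcs_imp_rooted[OF assms] by blast
  show ?thesis
    unfolding inner_commute[of "laplacian G *v x" y] laplacian_form_parent[OF p] by (simp add: mult.commute)
qed

lemma inner_1_vec: "x \<bullet> (1 :: real^'n) = (\<Sum>i\<in>UNIV. x $ i)"
  by (simp add: inner_vec_def)

text \<open>Zero energy forces equal values at a vertex and its parent, hence everywhere. So the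
  kernel is spanned by \<open>1\<close> and \<open>second_eigenvalue\<close> applies.\<close>

lemma tree_laplacian_spectrum:
  fixes G :: "'v::finite pair_pre_digraph"
  assumes tr: "tree_arcs (parcs G)" and card: "2 \<le> CARD('v)"
  shows "0 < algebraic_connectivity G" "\<exists>f. fiedler_vector G f"
    "\<And>x. (\<Sum>i\<in>UNIV. x $ i) = 0 \<Longrightarrow> algebraic_connectivity G * (x \<bullet> x) \<le> x \<bullet> (laplacian G *v x)"
    "laplacian G *v 1 = 0"
proof -
  \<comment> \<open>Any root will do; \<open>undefined\<close> is an arbitrary vertex.\<close>
  obtain p where p: "rooted p undefined" "parcs G = parent_arcs p"
    using tree_arcs_imp_rooted[OF tr] by blast
  note form = laplacian_form_parent[OF p]
  have L1: "laplacian G *v 1 = 0" by (simp add: vec_eq_iff laplacian_mult)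
  have ker: "laplacian G *v x = 0 \<longleftrightarrow> x \<in> span {1}" for x
  proof
    assume "laplacian G *v x = 0"
    then have "(\<Sum>i\<in>UNIV. (x $ i - x $ (p i)) * (x $ i - x $ (p i))) = 0" using form[of x x] by simp
    then have "x $ i = x $ (p i)" for i by (subst (asm) sum_nonneg_eq_0_iff) auto
    then have "x $ ((p ^^ k) i) = x $ i" for i k by (induction k) auto
    then have "x $ i = x $ undefined" for i using p(1) unfolding rooted_def by metis
    then have "x = (x $ undefined) *\<^sub>R 1" by (simp add: vec_eq_iff)
    then show "x \<in> span {1}" by (metis span_base span_scale singletonI)
  next
    assume "x \<in> span {1}"
    then show "laplacian G *v x = 0" using L1 by (auto simp: span_singleton matrix_vector_mult_scaleR)
  qed
  have psd: "0 \<le> x \<bullet> (laplacian G *v x)" for x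
    unfolding form by (intro sum_nonneg) simp
  note * = second_eigenvalue[OF laplacian_form_sym[OF tr] psd ker card]
  show "0 < algebraic_connectivity G" "\<exists>f. fiedler_vector G f"
    "\<And>x. (\<Sum>i\<in>UNIV. x $ i) = 0 \<Longrightarrow> algebraic_connectivity G * (x \<bullet> x) \<le> x \<bullet> (laplacian G *v x)"
    using * by (auto simp: algebraic_connectivity_def fiedler_vector_def inner_1_vec)
qed (simp add: vec_eq_iff laplacian_mult)

lemma fiedler_vector_sum:
  fixes G :: "'v::finite pair_pre_digraph"
  assumes "tree_arcs (parcs G)" "2 \<le> CARD('v)" "fiedler_vector G f"
  shows "(\<Sum>i\<in>UNIV. f $ i) = 0"
proof -
  have "algebraic_connectivity G * (f \<bullet> 1) = (laplacian G *v f) \<bullet> 1"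
    using assms(3) by (simp add: fiedler_vector_def eigenvector_def)
  also have "\<dots> = 0"
    using laplacian_form_sym[OF assms(1), of f 1] tree_laplacian_spectrum(4)[OF assms(1,2)] by simp
  finally show ?thesis using tree_laplacian_spectrum(1)[OF assms(1,2)] by (simp add: inner_1_vec)
qed

lemma fiedler_vectorI:
  fixes G :: "'v::finite pair_pre_digraph"
  assumes "tree_arcs (parcs G)" "2 \<le> CARD('v)" "f \<noteq> 0" "(\<Sum>i\<in>UNIV. f $ i) = 0"
    and "f \<bullet> (laplacian G *v f) = algebraic_connectivity G * (f \<bullet> f)"
  shows "fiedler_vector G f"
  using min_on_subspace_imp_eigenvector[OF laplacian_form_sym[OF assms(1)]
      tree_laplacian_spectrum(4)[OF assms(1,2)], of "algebraic_connectivity G" f]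
    tree_laplacian_spectrum(3)[OF assms(1,2)] assms(3-5)
  by (simp add: fiedler_vector_def eigenvector_def inner_1_vec)

text \<open>The spectral bound is applied to \<open>g\<close> minus its mean, which leaves the
  energy unchanged and lowers the squared norm by the subtracted term. Test vectors thus need not be
  centred.\<close>

lemma laplacian_form_ge:
  fixes G :: "'v::finite pair_pre_digraph"
  assumes "tree_arcs (parcs G)" "2 \<le> CARD('v)"
  shows "algebraic_connectivity G * (g \<bullet> g - (\<Sum>i\<in>UNIV. g $ i)\<^sup>2 / real CARD('v)) \<le> g \<bullet> (laplacian G *v g)"
proof -
  define s where "s = (\<Sum>i\<in>UNIV. g $ i)"
  define m where "m = s / real CARD('v)"
  define h where "h = g - m *\<^sub>R 1"
  have g1: "g \<bullet> 1 = s" by (simp add: inner_1_vec s_def)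
  have n1: "(1 :: real^'v) \<bullet> 1 = real CARD('v)" by (simp add: inner_1_vec)
  have mn: "m * real CARD('v) = s" using assms(2) by (simp add: m_def)
  have "(\<Sum>i\<in>UNIV. h $ i) = 0"
    unfolding inner_1_vec[symmetric] h_def inner_diff_left inner_scaleR_left g1 n1 using mn by simp
  from tree_laplacian_spectrum(3)[OF assms this]
  have "algebraic_connectivity G * (h \<bullet> h) \<le> h \<bullet> (laplacian G *v h)" .
  moreover have "h \<bullet> h = g \<bullet> g - m * s"
    unfolding h_def inner_diff_left inner_diff_right inner_scaleR_left inner_scaleR_right
      inner_commute[of 1 g] g1 n1 mn by simp
  moreover have "m * s = s\<^sup>2 / real CARD('v)" by (simp add: m_def power2_eq_square)
  moreover have Lh: "laplacian G *v h = laplacian G *v g"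
    using tree_laplacian_spectrum(4)[OF assms]
    by (simp add: h_def matrix_vector_mult_diff_distrib matrix_vector_mult_scaleR)
  moreover have "h \<bullet> (laplacian G *v g) = g \<bullet> (laplacian G *v g)"
    using laplacian_form_sym[OF assms(1), of h g] laplacian_form_sym[OF assms(1), of g g] Lh by simp
  ultimately show ?thesis unfolding s_def by simp
qed

section \<open>Exchanging branches\<close>

text \<open>\<open>W\<close> will be the vertex set of the path from the root \<open>u\<close> to
  \<open>v\<close>; its closure under \<open>p\<close> keeps that path in place. \<open>R1\<close>
  and \<open>R2\<close> hold the roots of the branches that are moved off \<open>u\<close> and off
  \<open>v\<close>.\<close>

locale branch_exchange =
  fixes p :: "'v::finite \<Rightarrow> 'v" and u v :: 'v and W R1 R2 :: "'v set"
  assumes rooted: "rooted p u" and uv: "u \<noteq> v"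
    and W: "u \<in> W" "v \<in> W" "\<And>x. x \<in> W \<Longrightarrow> p x \<in> W"
    and R1: "R1 \<inter> W = {}" "\<And>x. x \<in> R1 \<Longrightarrow> p x = u"
    and R2: "R2 \<inter> W = {}" "\<And>x. x \<in> R2 \<Longrightarrow> p x = v"
begin

definition p' :: "'v \<Rightarrow> 'v" where
  "p' x = (if x \<in> R1 then v else if x \<in> R2 then u else p x)"

text \<open>Iterates of \<open>p\<close> run through the ancestors of a vertex, so this is the union
  of the branches rooted in \<open>R1\<close>.\<close>

definition D1 :: "'v set" where "D1 = {x. \<exists>k. (p ^^ k) x \<in> R1}"
definition D2 :: "'v set" where "D2 = {x. \<exists>k. (p ^^ k) x \<in> R2}"

lemma pu: "p u = u" using rooted by (simp add: rooted_def)

lemma notin_R: "x \<in> W \<Longrightarrow> x \<notin> R1" "x \<in> W \<Longrightarrow> x \<notin> R2"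
  using R1 R2 by auto

lemma R_disjoint: "x \<in> R1 \<Longrightarrow> x \<notin> R2"
  using R1(2) R2(2) uv by metis

lemma funpow_W: "x \<in> W \<Longrightarrow> (p ^^ k) x \<in> W"
  by (induction k) (auto intro: W)

text \<open>Inside \<open>W\<close> the two parent functions agree; elsewhere a step of
  \<open>p'\<close> either enters \<open>W\<close> or is a step of \<open>p\<close>.\<close>

lemma rooted_p': "rooted p' u"
  unfolding rooted_def
proof (intro conjI allI)
  show "p' u = u" using notin_R[OF W(1)] pu by (simp add: p'_def)
  have inW: "\<exists>k. (p' ^^ k) x = u" if x: "x \<in> W" for x
  proof -
    have "(p' ^^ k) x = (p ^^ k) x" for k
    proof (induction k)
      case (Suc k)
      then show ?case using notin_R funpow_W[OF x, of k] by (simp add: p'_def)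
    qed simp
    then show ?thesis using rooted unfolding rooted_def by metis
  qed
  have "(p ^^ k) x = u \<Longrightarrow> \<exists>j. (p' ^^ j) x = u" for k x
  proof (induction k arbitrary: x)
    case 0
    then show ?case by (intro exI[of _ 0]) simp
  next
    case (Suc k)
    have "p' x \<in> W \<or> p' x = p x" using W by (auto simp: p'_def)
    then obtain j where "(p' ^^ j) (p' x) = u"
      using Suc inW by (metis comp_apply funpow_Suc_right)
    then show ?case by (intro exI[of _ "Suc j"]) (simp add: funpow_swap1)
  qed
  then show "\<exists>k. (p' ^^ k) x = u" for x using rooted unfolding rooted_def by metis
qed

lemma D_disjoint_W: "x \<in> W \<Longrightarrow> x \<notin> D1" "x \<in> W \<Longrightarrow> x \<notin> D2"
  unfolding D1_def D2_def using funpow_W notin_R by blast+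

lemma R_subset_D: "x \<in> R1 \<Longrightarrow> x \<in> D1" "x \<in> R2 \<Longrightarrow> x \<in> D2"
  unfolding D1_def D2_def by (metis (mono_tags) funpow_0 mem_Collect_eq)+

lemma D_step: "x \<notin> R1 \<Longrightarrow> p x \<in> D1 \<longleftrightarrow> x \<in> D1" "x \<notin> R2 \<Longrightarrow> p x \<in> D2 \<longleftrightarrow> x \<in> D2"
proof -
  have *: "(\<exists>k. (p ^^ k) (p x) \<in> R) \<longleftrightarrow> (\<exists>k. (p ^^ k) x \<in> R)" if nin: "x \<notin> R" for R
  proof
    assume "\<exists>k. (p ^^ k) (p x) \<in> R"
    then show "\<exists>k. (p ^^ k) x \<in> R" by (metis comp_apply funpow_Suc_right)
  next
    assume "\<exists>k. (p ^^ k) x \<in> R"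
    then obtain k where k: "(p ^^ k) x \<in> R" by blast
    then obtain j where "k = Suc j" using nin by (cases k) auto
    then have "(p ^^ j) (p x) \<in> R" using k by (simp add: funpow_swap1)
    then show "\<exists>k. (p ^^ k) (p x) \<in> R" ..
  qed
  show "x \<notin> R1 \<Longrightarrow> p x \<in> D1 \<longleftrightarrow> x \<in> D1" "x \<notin> R2 \<Longrightarrow> p x \<in> D2 \<longleftrightarrow> x \<in> D2"
    unfolding D1_def D2_def using *[of R1] *[of R2] by auto
qed

text \<open>If the iterates of a vertex met \<open>R1\<close> and \<open>R2\<close> at different
  times, the later meeting would come after a step to \<open>u\<close> or \<open>v\<close> and hence
  lie in \<open>W\<close>, which avoids both sets. Simultaneous meetings contradict
  \<open>R_disjoint\<close>.\<close>

lemma D_disjoint: "D1 \<inter> D2 = {}"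
proof (rule ccontr)
  assume "D1 \<inter> D2 \<noteq> {}"
  then obtain x j k where x: "(p ^^ j) x \<in> R1" "(p ^^ k) x \<in> R2"
    by (auto simp: D1_def D2_def)
  have later: "(p ^^ (b - a)) ((p ^^ a) x) = (p ^^ b) x" if "a \<le> b" for a b
    using that by (metis comp_apply funpow_add le_add_diff_inverse2)
  have W': "(p ^^ i) y \<in> W" if "p y \<in> W" "0 < i" for i y
    using that funpow_W[of "p y" "i - 1"] by (cases i) (auto simp: funpow_swap1)
  consider "j = k" | "j < k" | "k < j" by linarith
  then show False
  proof cases
    case 1
    then show False using x R_disjoint by auto
  next
    case 2
    have "p ((p ^^ j) x) \<in> W" using R1(2)[OF x(1)] W by simp
    from W'[OF this, of "k - j"] have "(p ^^ k) x \<in> W" using later[of j k] 2 by simp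
    then show False using notin_R x by blast
  next
    case 3
    have "p ((p ^^ k) x) \<in> W" using R2(2)[OF x(2)] W by simp
    from W'[OF this, of "j - k"] have "(p ^^ j) x \<in> W" using later[of k j] 3 by simp
    then show False using notin_R x by blast
  qed
qed

lemma nbrs_p':
  "parent_arcs p' `` {u} = parent_arcs p `` {u} - R1 \<union> R2"
  "parent_arcs p' `` {v} = parent_arcs p `` {v} - R2 \<union> R1"
  "x \<in> R1 \<Longrightarrow> parent_arcs p' `` {x} = insert v (parent_arcs p `` {x} - {u})"
  "x \<in> R2 \<Longrightarrow> parent_arcs p' `` {x} = insert u (parent_arcs p `` {x} - {v})"
  "x \<notin> {u, v} \<union> R1 \<union> R2 \<Longrightarrow> parent_arcs p' `` {x} = parent_arcs p `` {x}"
proof -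
  note simps = notin_R[OF W(1)] notin_R[OF W(2)] pu uv uv[symmetric] p'_def parent_arcs_def
  have pv: "p v \<in> W" using W by blast
  have neW: "y \<noteq> u" "y \<noteq> v" "y \<noteq> p v" "p v \<noteq> y" if "y \<in> R1 \<union> R2" for y
    using that notin_R pv W by auto
  show "parent_arcs p' `` {u} = parent_arcs p `` {u} - R1 \<union> R2"
    using R2 neW R_disjoint by (auto simp: simps)
  show "parent_arcs p' `` {v} = parent_arcs p `` {v} - R2 \<union> R1"
    using R1 neW R_disjoint by (auto simp: simps)
  have child: "p' y = x \<longleftrightarrow> p y = x" if "x \<notin> W" for x y
    using that W R1(2) R2(2) by (auto simp: p'_def)
  have nW: "x \<notin> W" "x \<noteq> u" "x \<noteq> v" "p u \<noteq> x" if "x \<in> R1 \<union> R2" for x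
    using that R1(1) R2(1) W pu by auto
  show "parent_arcs p' `` {x} = insert v (parent_arcs p `` {x} - {u})" if x: "x \<in> R1"
  proof -
    have "p' x = v" "p x = u" using x R1(2) by (auto simp: p'_def)
    then show ?thesis using nW[of x] x child[of x] uv unfolding parent_arcs_def by auto
  qed
  show "parent_arcs p' `` {x} = insert u (parent_arcs p `` {x} - {v})" if x: "x \<in> R2"
  proof -
    have "p' x = u" "p x = v" using x R2(2) R_disjoint by (auto simp: p'_def)
    moreover have "p v \<noteq> x" using W nW x by blast
    ultimately show ?thesis using nW[of x] x child[of x] uv unfolding parent_arcs_def by auto
  qed
  show "parent_arcs p' `` {x} = parent_arcs p `` {x}" if x: "x \<notin> {u, v} \<union> R1 \<union> R2"
  proof -
    have "p' x = p x" using x by (auto simp: p'_def)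
    moreover have "p' y = x \<longleftrightarrow> p y = x" for y using x R1(2) R2(2) by (auto simp: p'_def)
    ultimately show ?thesis unfolding parent_arcs_def by auto
  qed
qed

text \<open>The two attachment vertices trade branches, while each branch root replaces one
  neighbour by another.\<close>

lemma card_nbrs_p':
  "card (parent_arcs p' `` {u}) + card R1 = card (parent_arcs p `` {u}) + card R2"
  "card (parent_arcs p' `` {v}) + card R2 = card (parent_arcs p `` {v}) + card R1"
  "x \<noteq> u \<Longrightarrow> x \<noteq> v \<Longrightarrow> card (parent_arcs p' `` {x}) = card (parent_arcs p `` {x})"
proof -
  have pv: "p v \<in> W" using W by blast
  have sub: "R1 \<subseteq> parent_arcs p `` {u}" "R2 \<subseteq> parent_arcs p `` {v}"
    using R1 R2 W by (auto simp: parent_arcs_def)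
  have dis: "R2 \<inter> parent_arcs p `` {u} = {}" "R1 \<inter> parent_arcs p `` {v} = {}"
    using R1 R2 W uv pv pu by (auto simp: parent_arcs_def)
  have exch: "card (N - A \<union> B) + card A = card N + card B" if "A \<subseteq> N" "B \<inter> N = {}" for A B N :: "'v set"
  proof -
    have "card (N - A \<union> B) = card (N - A) + card B" using that by (intro card_Un_disjoint) auto
    moreover have "card (N - A) + card A = card N"
      using that by (metis card_Diff_subset card_mono finite_code le_add_diff_inverse2 rev_finite_subset)
    ultimately show ?thesis by simp
  qed
  show "card (parent_arcs p' `` {u}) + card R1 = card (parent_arcs p `` {u}) + card R2"
    unfolding nbrs_p' by (rule exch[OF sub(1) dis(1)])
  show "card (parent_arcs p' `` {v}) + card R2 = card (parent_arcs p `` {v}) + card R1"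
    unfolding nbrs_p' by (rule exch[OF sub(2) dis(2)])
  show "card (parent_arcs p' `` {x}) = card (parent_arcs p `` {x})" if x: "x \<noteq> u" "x \<noteq> v"
  proof -
    consider "x \<in> R1" | "x \<in> R2" | "x \<notin> {u, v} \<union> R1 \<union> R2" using x by blast
    then show ?thesis
    proof cases
      case 1
      have "v \<notin> parent_arcs p `` {x}" "u \<in> parent_arcs p `` {x}"
        using 1 dis(2) sub(1) by (auto simp: parent_arcs_def)
      then show ?thesis unfolding nbrs_p'(3)[OF 1]
        by (metis DiffD1 card.remove card_insert_disjoint finite_code)
    next
      case 2
      have "u \<notin> parent_arcs p `` {x}" "v \<in> parent_arcs p `` {x}"
        using 2 dis(1) sub(2) by (auto simp: parent_arcs_def)
      then show ?thesis unfolding nbrs_p'(4)[OF 2]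
        by (metis DiffD1 card.remove card_insert_disjoint finite_code)
    next
      case 3
      then show ?thesis by (simp add: nbrs_p'(5))
    qed
  qed
qed

text \<open>Moving the branches rigidly, i.e. shifting \<open>f\<close> on them by the difference
  of the values at the two attachment vertices, leaves all edge differences unchanged.\<close>

lemma shifted_difference:
  fixes f :: "'v \<Rightarrow> real"
  defines "g \<equiv> \<lambda>x. f x + (f v - f u) * (of_bool (x \<in> D1) - of_bool (x \<in> D2))"
  shows "g x - g (p' x) = f x - f (p x)"
proof -
  have D: "x \<notin> D1 \<or> x \<notin> D2" using D_disjoint by auto
  note W' = D_disjoint_W[OF W(1)] D_disjoint_W[OF W(2)]
  consider "x \<in> R1" | "x \<in> R2" | "x \<notin> R1" "x \<notin> R2" by blast
  then show ?thesis
  proof cases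
    case 1
    then show ?thesis using R_subset_D D W' R1(2) by (auto simp: g_def p'_def)
  next
    case 2
    then show ?thesis using R_subset_D D W' R2(2) R_disjoint by (auto simp: g_def p'_def)
  next
    case 3
    then show ?thesis using D_step[of x] by (simp add: g_def p'_def)
  qed
qed

text \<open>Discrete divergence theorem: pairing with the indicator of the branches leaves only the
  edges from the branch roots to the attachment vertex. For an eigenvector this makes the sum over
  whole branches a local quantity.\<close>

lemma sum_D1:
  fixes f :: "real^'v"
  assumes "parcs G = parent_arcs p"
  shows "(\<Sum>x\<in>D1. (laplacian G *v f) $ x) = (\<Sum>r\<in>R1. f $ r - f $ u)"
    and "(\<Sum>x\<in>D2. (laplacian G *v f) $ x) = (\<Sum>r\<in>R2. f $ r - f $ v)"
proof -
  have *: "(\<Sum>x\<in>D. (laplacian G *v f) $ x) = (\<Sum>r\<in>R. f $ r - f $ w)"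
    if D: "\<And>x. x \<notin> R \<Longrightarrow> p x \<in> D \<longleftrightarrow> x \<in> D" "R \<subseteq> D" "w \<notin> D" "\<And>x. x \<in> R \<Longrightarrow> p x = w"
    for D R w
  proof -
    define g :: "real^'v" where "g = (\<chi> x. of_bool (x \<in> D))"
    have "(\<Sum>x\<in>D. (laplacian G *v f) $ x) = g \<bullet> (laplacian G *v f)"
      by (simp add: g_def inner_vec_def of_bool_def if_distrib[of "\<lambda>x. x * _"] sum.If_cases cong: if_cong)
    also have "\<dots> = (\<Sum>x\<in>UNIV. (g $ x - g $ (p x)) * (f $ x - f $ (p x)))"
      by (rule laplacian_form_parent[OF rooted assms])
    also have "\<dots> = (\<Sum>x\<in>R. (g $ x - g $ (p x)) * (f $ x - f $ (p x)))"
      using D(1) by (intro sum.mono_neutral_right) (auto simp: g_def)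
    also have "\<dots> = (\<Sum>r\<in>R. f $ r - f $ w)"
      using D by (intro sum.cong) (auto simp: g_def)
    finally show ?thesis .
  qed
  show "(\<Sum>x\<in>D1. (laplacian G *v f) $ x) = (\<Sum>r\<in>R1. f $ r - f $ u)"
    using * D_step(1) R_subset_D(1) D_disjoint_W(1)[OF W(1)] R1(2) by blast
  show "(\<Sum>x\<in>D2. (laplacian G *v f) $ x) = (\<Sum>r\<in>R2. f $ r - f $ v)"
    using * D_step(2) R_subset_D(2) D_disjoint_W(2)[OF W(2)] R2(2) by blast
qed

end

section \<open>Minimal trees and the local exchange rule\<close>

text \<open>The vector \<open>f\<close> is a parameter so that the locale can also be instantiated
  with \<open>- f\<close>.\<close>

locale minimal_tree =
  fixes T :: "'v::finite pair_pre_digraph" and f :: "real^'v"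
  assumes tree: "tree_arcs (parcs T)" and card: "2 \<le> CARD('v)"
    and minimal: "\<And>T' :: 'v pair_pre_digraph. tree_arcs (parcs T') \<Longrightarrow> pverts T' = UNIV \<Longrightarrow>
      image_mset (vertex_degree T') (mset_set UNIV) = image_mset (vertex_degree T) (mset_set UNIV) \<Longrightarrow>
      algebraic_connectivity T \<le> algebraic_connectivity T'"
    and fiedler: "fiedler_vector T f"
begin

abbreviation \<alpha> :: real where "\<alpha> \<equiv> algebraic_connectivity T"
abbreviation N :: "'v \<Rightarrow> 'v set" where "N x \<equiv> parcs T `` {x}"
abbreviation deg :: "'v \<Rightarrow> nat" where "deg \<equiv> vertex_degree T"

lemma Lf: "laplacian T *v f = \<alpha> *\<^sub>R f" and f_nonzero: "f \<noteq> 0"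
  using fiedler by (simp_all add: fiedler_vector_def eigenvector_def)

lemma \<alpha>_pos: "0 < \<alpha>"
  by (rule tree_laplacian_spectrum[OF tree card])

lemma sum_f: "(\<Sum>x\<in>UNIV. f $ x) = 0"
  by (rule fiedler_vector_sum[OF tree card fiedler])

lemma eigen_eq: "\<alpha> * f $ x = (\<Sum>y\<in>N x. f $ x - f $ y)"
  using laplacian_mult[of T f x] by (simp add: Lf)

text \<open>With \<open>S1\<close> and \<open>S2\<close> the sums of \<open>f\<close> over the moved
  branches, the left side is the sign of \<open>S2 - S1\<close>. It is found by comparing variances
  if \<open>f $ u \<noteq> f $ v\<close>, and by comparing two eigenvalue equations if these values
  agree. The alternative on degrees is between keeping and swapping them.\<close>

lemma exchange:
  assumes ws: "graph_path (parcs T) ws" "ws \<noteq> []" "hd ws = u" "last ws = v" and uv: "u \<noteq> v"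
    and R: "R1 \<subseteq> N u - set ws" "R2 \<subseteq> N v - set ws" "R1 \<union> R2 \<noteq> {}"
    and deg: "card R1 = card R2 \<or> card R1 + deg v = card R2 + deg u"
  shows "sgn ((\<Sum>s\<in>R2. f $ s - f $ v) - (\<Sum>r\<in>R1. f $ r - f $ u)) = sgn (f $ v - f $ u)"
proof -
  obtain p where p: "rooted p u" "parcs T = parent_arcs p"
    using tree_arcs_imp_rooted[OF tree] by blast
  have pu: "p u = u" using p(1) by (simp add: rooted_def)
  have succ: "successively (\<lambda>x y. p y = x) ws"
    using graph_path_from_root[OF p(1)] ws p(2) by simp
  have pW: "p x \<in> set ws" if x: "x \<in> set ws" for x
  proof -
    obtain i where i: "i < length ws" "x = ws ! i" using x by (auto simp: in_set_conv_nth)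
    show ?thesis
    proof (cases i)
      case 0
      then have "x = u" using i(2) ws(2,3) by (simp add: hd_conv_nth)
      then show ?thesis using pu x by simp
    next
      case (Suc j)
      then have "p x = ws ! j" "j < length ws" using i successively_nth[OF succ, of j] by simp_all
      then show ?thesis by simp
    qed
  qed
  have uvW: "u \<in> set ws" "v \<in> set ws" using ws by auto
  interpret branch_exchange p u v "set ws" R1 R2
  proof
    show "x \<in> R1 \<Longrightarrow> p x = u" for x using R(1) pu by (auto simp: p(2) parent_arcs_def)
    show "x \<in> R2 \<Longrightarrow> p x = v" for x using R(2) pW[OF uvW(2)] by (auto simp: p(2) parent_arcs_def)
  qed (use p uv uvW pW R in auto)
  define T' :: "'v pair_pre_digraph" where "T' = \<lparr>pverts = UNIV, parcs = parent_arcs p'\<rparr>"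
  have T': "tree_arcs (parcs T')" "pverts T' = UNIV" "parcs T' = parent_arcs p'"
    using rooted_imp_tree_arcs[OF rooted_p'] by (simp_all add: T'_def)
  have degs: "image_mset (vertex_degree T') (mset_set UNIV) = image_mset deg (mset_set UNIV)"
  proof -
    have d: "vertex_degree T' u + card R1 = deg u + card R2"
       "vertex_degree T' v + card R2 = deg v + card R1"
       "\<And>x. x \<noteq> u \<Longrightarrow> x \<noteq> v \<Longrightarrow> vertex_degree T' x = deg x"
      using card_nbrs_p' by (simp_all add: vertex_degree_conv T'(3) p(2))
    show ?thesis
    proof (cases "card R1 = card R2")
      case True
      then have "vertex_degree T' x = deg x" for x using d by (cases "x = u"; cases "x = v") auto
      then have "vertex_degree T' = deg" by (rule ext)
      then show ?thesis by simp
    next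
      case False
      \<comment> \<open>The degrees of \<open>u\<close> and \<open>v\<close> are swapped: the degree
        function is composed with a transposition, which preserves the multiset.\<close>
      then have "card R1 + deg v = card R2 + deg u" using deg by simp
      then have "vertex_degree T' x = deg (Transposition.transpose u v x)" for x
        using d uv by (cases "x = u"; cases "x = v") auto
      then have "vertex_degree T' = deg \<circ> Transposition.transpose u v" by (simp add: fun_eq_iff)
      then have "image_mset (vertex_degree T') (mset_set UNIV)
          = image_mset deg (image_mset (Transposition.transpose u v) (mset_set UNIV))"
        by (simp add: multiset.map_comp)
      also have "image_mset (Transposition.transpose u v) (mset_set UNIV) = mset_set UNIV"
        by (subst image_mset_mset_set) (auto intro!: injI dest: arg_cong[of _ _ "Transposition.transpose u v"])
      finally show ?thesis .
    qed
  qed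
  from minimal[OF T'(1,2) degs] have \<alpha>': "\<alpha> \<le> algebraic_connectivity T'" .
  define c where "c = f $ v - f $ u"
  define S1 where "S1 = (\<Sum>x\<in>D1. f $ x)"
  define S2 where "S2 = (\<Sum>x\<in>D2. f $ x)"
  have S1: "\<alpha> * S1 = (\<Sum>r\<in>R1. f $ r - f $ u)" and S2: "\<alpha> * S2 = (\<Sum>r\<in>R2. f $ r - f $ v)"
    using sum_D1[OF p(2), of f] by (simp_all add: Lf S1_def S2_def sum_distrib_left)
  have diff: "(\<Sum>s\<in>R2. f $ s - f $ v) - (\<Sum>r\<in>R1. f $ r - f $ u) = \<alpha> * (S2 - S1)"
    unfolding S1[symmetric] S2[symmetric] by (simp add: algebra_simps)
  have sgn_diff: "sgn ((\<Sum>s\<in>R2. f $ s - f $ v) - (\<Sum>r\<in>R1. f $ r - f $ u)) = sgn (S2 - S1)"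
    unfolding diff using \<alpha>_pos by (simp add: sgn_mult)
  define \<delta> where "\<delta> x = c * (of_bool (x \<in> D1) - of_bool (x \<in> D2))" for x
  define g :: "real^'v" where "g = (\<chi> x. f $ x + \<delta> x)"
  have gd: "g $ x - g $ (p' x) = f $ x - f $ (p x)" for x
    using shifted_difference[of "\<lambda>x. f $ x" x] by (simp add: g_def \<delta>_def c_def)
  have gL: "g \<bullet> (laplacian T' *v g) = f \<bullet> (laplacian T *v f)"
    unfolding laplacian_form_parent[OF rooted_p' T'(3)] laplacian_form_parent[OF p] gd ..
  have fL: "f \<bullet> (laplacian T *v f) = \<alpha> * (f \<bullet> f)" by (simp add: Lf)
  show ?thesis
  proof (cases "c = 0")
    \<comment> \<open>Nothing is shifted, so \<open>f\<close> has energy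
      \<open>\<alpha> * (f \<bullet> f)\<close> on \<open>T'\<close> as well. Minimality makes it a
      Fiedler vector of \<open>T'\<close>, and comparing the two eigenvalue equations at
      \<open>u\<close> balances the exchanged branches.\<close>
    case True
    then have "g = f" by (simp add: g_def \<delta>_def vec_eq_iff)
    then have eq: "f \<bullet> (laplacian T' *v f) = \<alpha> * (f \<bullet> f)" using gL fL by simp
    have ff: "0 < f \<bullet> f" using f_nonzero by simp
    have "algebraic_connectivity T' * (f \<bullet> f) \<le> \<alpha> * (f \<bullet> f)"
      using tree_laplacian_spectrum(3)[OF T'(1) card sum_f] eq by simp
    then have "algebraic_connectivity T' = \<alpha>" using ff \<alpha>' by simp
    then have "laplacian T' *v f = \<alpha> *\<^sub>R f"
      using fiedler_vectorI[OF T'(1) card f_nonzero sum_f] eq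
      by (simp add: fiedler_vector_def eigenvector_def)
    then have "(laplacian T' *v f) $ u = (laplacian T *v f) $ u" by (simp add: Lf)
    then have "(\<Sum>y\<in>N u - R1 \<union> R2. f $ u - f $ y) = (\<Sum>y\<in>N u. f $ u - f $ y)"
      unfolding laplacian_mult using nbrs_p'(1) by (simp add: T'(3) p(2))
    moreover have "R2 \<inter> N u = {}" using R2 W uv pu by (auto simp: p(2) parent_arcs_def)
    then have "(\<Sum>y\<in>N u - R1 \<union> R2. f $ u - f $ y) = (\<Sum>y\<in>N u - R1. f $ u - f $ y) + (\<Sum>y\<in>R2. f $ u - f $ y)"
      by (intro sum.union_disjoint) auto
    moreover have "(\<Sum>y\<in>N u. f $ u - f $ y) = (\<Sum>y\<in>N u - R1. f $ u - f $ y) + (\<Sum>y\<in>R1. f $ u - f $ y)"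
      using R(1) by (intro sum.subset_diff) auto
    ultimately have "(\<Sum>y\<in>R2. f $ u - f $ y) = (\<Sum>y\<in>R1. f $ u - f $ y)" by simp
    moreover have "f $ v = f $ u" using True by (simp add: c_def)
    ultimately have "(\<Sum>s\<in>R2. f $ s - f $ v) = (\<Sum>r\<in>R1. f $ r - f $ u)"
      by (simp add: sum_subtractf)
    then show ?thesis using \<open>f $ v = f $ u\<close> by simp
  next
    case False
    define d1 d2 where "d1 = real (card D1)" and "d2 = real (card D2)"
    define n where "n = real CARD('v)"
    have ind: "(\<Sum>x\<in>UNIV. h x * of_bool (x \<in> D)) = (\<Sum>x\<in>D. h x)" for h :: "'v \<Rightarrow> real" and D
      by (simp add: of_bool_def if_distrib[of "\<lambda>x. _ * x"] sum.If_cases cong: if_cong)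
    have ind': "(\<Sum>x\<in>UNIV. of_bool (x \<in> D)) = real (card D)" for D :: "'v set"
      using ind[of "\<lambda>_. 1" D] by simp
    have \<delta>2: "\<delta> x * \<delta> x = c\<^sup>2 * (of_bool (x \<in> D1) + of_bool (x \<in> D2))" for x
      using D_disjoint by (auto simp: \<delta>_def power2_eq_square)
    have "(\<Sum>x\<in>UNIV. \<delta> x) = c * (d1 - d2)"
      unfolding \<delta>_def sum_distrib_left[symmetric] sum_subtractf ind' d1_def d2_def ..
    then have sum_g: "(\<Sum>x\<in>UNIV. g $ x) = c * (d1 - d2)"
      by (simp add: g_def sum.distrib sum_f)
    have "(\<Sum>x\<in>UNIV. f $ x * \<delta> x) = c * ((\<Sum>x\<in>UNIV. f $ x * of_bool (x \<in> D1)) - (\<Sum>x\<in>UNIV. f $ x * of_bool (x \<in> D2)))"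
      unfolding \<delta>_def sum_distrib_left sum_subtractf[symmetric] by (intro sum.cong) (auto simp: algebra_simps)
    then have f\<delta>: "(\<Sum>x\<in>UNIV. f $ x * \<delta> x) = c * (S1 - S2)"
      unfolding ind S1_def S2_def .
    have \<delta>\<delta>: "(\<Sum>x\<in>UNIV. \<delta> x * \<delta> x) = c\<^sup>2 * (d1 + d2)"
      unfolding \<delta>2 sum_distrib_left[symmetric] sum.distrib ind' d1_def d2_def ..
    have "g \<bullet> g = (\<Sum>x\<in>UNIV. f $ x * f $ x + 2 * (f $ x * \<delta> x) + \<delta> x * \<delta> x)"
      by (simp add: inner_vec_def g_def algebra_simps)
    also have "\<dots> = f \<bullet> f + 2 * (c * (S1 - S2)) + c\<^sup>2 * (d1 + d2)"
      unfolding sum.distrib sum_distrib_left[symmetric] f\<delta> \<delta>\<delta> by (simp add: inner_vec_def)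
    finally have gg: "g \<bullet> g = f \<bullet> f + 2 * (c * (S1 - S2)) + c\<^sup>2 * (d1 + d2)" .
    have d: "0 \<le> d1" "0 \<le> d2" "0 < d1 + d2" "d1 + d2 < n"
    proof -
      have "0 < card D1 + card D2"
        using R(3) R_subset_D by (auto simp: card_gt_0_iff)
      then show "0 < d1 + d2" unfolding d1_def d2_def of_nat_add[symmetric] of_nat_0_less_iff .
      have "card D1 + card D2 = card (D1 \<union> D2)" using D_disjoint by (simp add: card_Un_disjoint)
      also have "\<dots> < CARD('v)"
        using D_disjoint_W[OF uvW(1)] by (intro psubset_card_mono) auto
      finally show "d1 + d2 < n" unfolding d1_def d2_def n_def of_nat_add[symmetric] of_nat_less_iff .
    qed (simp_all add: d1_def d2_def)
    \<comment> \<open>The part of the change in centred squared norm that is quadratic in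
      \<open>c\<close>: the squared shift minus the correction for the mean. It is positive because
      the branches do not exhaust the vertices.\<close>
    define V where "V = c\<^sup>2 * (d1 + d2) - (c * (d1 - d2))\<^sup>2 / n"
    have "0 < V"
    proof -
      have "(d1 - d2)\<^sup>2 \<le> (d1 + d2)\<^sup>2" using d by (intro abs_le_square_iff[THEN iffD1]) auto
      also have "\<dots> < (d1 + d2) * n" using d by (simp add: power2_eq_square)
      finally have "(d1 - d2)\<^sup>2 / n < d1 + d2" using d by (simp add: field_simps)
      then have "c\<^sup>2 * ((d1 - d2)\<^sup>2 / n) < c\<^sup>2 * (d1 + d2)"
        by (rule mult_strict_left_mono) (use False in simp)
      then show ?thesis by (simp add: V_def power_mult_distrib)
    qed
    have "algebraic_connectivity T' * (f \<bullet> f + 2 * (c * (S1 - S2)) + V) \<le> \<alpha> * (f \<bullet> f)"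
      using laplacian_form_ge[OF T'(1) card, of g] gL fL
      by (simp add: gg sum_g V_def n_def algebra_simps)
    \<comment> \<open>Otherwise the centred squared norm would grow at fixed energy and push the
      connectivity of \<open>T'\<close> below \<open>\<alpha>\<close>.\<close>
    then have cS: "c * (S1 - S2) < 0"
    proof (rule contrapos_pp)
      assume "\<not> c * (S1 - S2) < 0"
      then have *: "f \<bullet> f < f \<bullet> f + 2 * (c * (S1 - S2)) + V" using \<open>0 < V\<close> by simp
      have "\<alpha> * (f \<bullet> f) < \<alpha> * (f \<bullet> f + 2 * (c * (S1 - S2)) + V)"
        using * \<alpha>_pos by simp
      also have "\<dots> \<le> algebraic_connectivity T' * (f \<bullet> f + 2 * (c * (S1 - S2)) + V)"
        using \<alpha>' * inner_ge_zero[of f] by (intro mult_right_mono) linarith+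
      finally show "\<not> algebraic_connectivity T' * (f \<bullet> f + 2 * (c * (S1 - S2)) + V) \<le> \<alpha> * (f \<bullet> f)"
        by simp
    qed
    then have "sgn (S2 - S1) = sgn c"
      using False by (cases "0 < c") (auto simp: mult_less_0_iff sgn_if)
    then show ?thesis unfolding sgn_diff c_def .
  qed
qed

end

section \<open>The shape of a Fiedler vector on a minimal tree\<close>

lemma in_zip_tl_iff: "(x, y) \<in> set (zip ws (tl ws)) \<longleftrightarrow> (\<exists>as bs. ws = as @ x # y # bs)"
proof
  show "(x, y) \<in> set (zip ws (tl ws)) \<Longrightarrow> \<exists>as bs. ws = as @ x # y # bs"
  proof (induction ws rule: induct_list012)
    case (3 a b zs)
    then consider "x = a" "y = b" | "(x, y) \<in> set (zip (b # zs) (tl (b # zs)))" by auto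
    then show ?case
    proof cases
      case 1
      then have "a # b # zs = [] @ x # y # zs" by simp
      then show ?thesis by blast
    next
      case 2
      then obtain as bs where "b # zs = as @ x # y # bs" using 3 by blast
      then have "a # b # zs = (a # as) @ x # y # bs" by simp
      then show ?thesis by blast
    qed
  qed auto
  have "(x, y) \<in> set (zip (as @ x # y # bs) (tl (as @ x # y # bs)))" for as bs
    by (induction as rule: induct_list012) auto
  then show "\<exists>as bs. ws = as @ x # y # bs \<Longrightarrow> (x, y) \<in> set (zip ws (tl ws))" by blast
qed

text \<open>A chord of a path in a tree joins the ends of a subpath, which by
  \<open>tree_arcs_length_2\<close> is then a single edge.\<close>

lemma path_along_induced:
  assumes tree: "tree_arcs (parcs G)" and ws: "graph_path (parcs G) ws"
  shows "path_along (with_proj G \<restriction> set ws) ws"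
proof -
  let ?Z = "set (zip ws (tl ws))"
  have symG: "sym (parcs G)" and irr: "(x, x) \<notin> parcs G" for x
    using tree by (auto simp: tree_arcs_def irrefl_def)
  have ends: "arcs_ends (with_proj G \<restriction> set ws) = {(x, y) \<in> parcs G. x \<in> set ws \<and> y \<in> set ws}"
    by (auto simp: arcs_ends_conv induce_subgraph_def image_iff)
  have fwd: "(x, y) \<in> ?Z" if "(x, y) \<in> parcs G" "ws = as @ x # cs @ y # ds" for x y as cs ds
  proof -
    have "graph_path (parcs G) (as @ (x # cs @ [y]) @ ds)" using ws that(2) by simp
    then have "graph_path (parcs G) (x # cs @ [y])" unfolding graph_path_append by blast
    then have "length (x # cs @ [y]) = 2" using tree_arcs_length_2[OF tree, of "x # cs @ [y]"] that(1) by simp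
    then show ?thesis using that(2) by (auto simp: in_zip_tl_iff)
  qed
  have "arcs_ends (with_proj G \<restriction> set ws) = ?Z \<union> ?Z\<inverse>"
  proof (intro equalityI subrelI)
    fix x y assume "(x, y) \<in> arcs_ends (with_proj G \<restriction> set ws)"
    then have xy: "(x, y) \<in> parcs G" "x \<in> set ws" "y \<in> set ws" unfolding ends by auto
    obtain as bs where ws': "ws = as @ x # bs" using xy(2) by (meson split_list)
    have "y \<noteq> x" using xy irr by auto
    then consider "y \<in> set bs" | "y \<in> set as" using xy(3) ws' by auto
    then show "(x, y) \<in> ?Z \<union> ?Z\<inverse>"
    proof cases
      case 1
      then obtain cs ds where "bs = cs @ y # ds" by (meson split_list)
      then show ?thesis using fwd[of x y as cs ds] xy ws' by simp
    next
      case 2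
      then obtain cs ds where "as = cs @ y # ds" by (meson split_list)
      then have "(y, x) \<in> ?Z" using fwd[of y x cs ds bs] xy ws' symD[OF symG] by simp
      then show ?thesis using xy by simp
    qed
  next
    fix x y assume "(x, y) \<in> ?Z \<union> ?Z\<inverse>"
    moreover have "(a, b) \<in> parcs G \<and> a \<in> set ws \<and> b \<in> set ws" if "(a, b) \<in> ?Z" for a b
    proof -
      obtain as bs where "ws = as @ a # b # bs" using \<open>(a, b) \<in> ?Z\<close> by (auto simp: in_zip_tl_iff)
      then show ?thesis using ws by (auto simp: graph_path_append)
    qed
    ultimately show "(x, y) \<in> arcs_ends (with_proj G \<restriction> set ws)"
      unfolding ends using symD[OF symG] by blast
  qed
  then show ?thesis using ws by (simp add: path_along_def graph_path_def induce_subgraph_def)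
qed

text \<open>Another neighbour of \<open>a\<close> on the path would give a chord. Contrapositively,
  every further neighbour of an end vertex lies off the path and can prolong it.\<close>

lemma nbr_on_path:
  assumes tree: "tree_arcs A" and path: "graph_path A (a # b # ws)"
    and z: "(a, z) \<in> A" "z \<in> set (a # b # ws)"
  shows "z = b"
proof -
  have "z \<noteq> a" using tree z(1) by (auto simp: tree_arcs_def irrefl_def)
  then have "z \<in> set (b # ws)" using z(2) by auto
  then obtain as bs where *: "b # ws = as @ z # bs" by (meson split_list)
  then have "graph_path A ((a # as @ [z]) @ bs)" using path by simp
  then have "graph_path A (a # as @ [z])" unfolding graph_path_append by blast
  then have "length (a # as @ [z]) = 2" using tree_arcs_length_2[OF tree, of "a # as @ [z]"] z by simp
  then show ?thesis using * by simp
qed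

context minimal_tree
begin

text \<open>This symmetry carries results about nonnegative values over to nonpositive ones.\<close>

lemma minimal_tree_uminus: "minimal_tree T (- f)"
proof
  show "fiedler_vector T (- f)"
    using fiedler by (simp add: fiedler_vector_def eigenvector_def linear_neg[OF matrix_vector_mul_linear])
qed (fact tree card minimal)+

lemma N_sym: "y \<in> N x \<longleftrightarrow> x \<in> N y" and N_irrefl: "x \<notin> N x"
  using tree by (auto simp: tree_arcs_def irrefl_def dest: symD)

lemma symA: "sym (parcs T)"
  using tree by (simp add: tree_arcs_def)

lemma deg_card: "deg x = card (N x)"
  by (rule vertex_degree_conv)

lemma deg_pos: "0 < deg x"
proof -
  obtain y where "y \<noteq> x"
    using card by (metis (full_types) UNIV_I card_le_Suc0_iff_eq finite_code not_less_eq_eq numeral_2_eq_2)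
  moreover have "(x, y) \<in> (parcs T)\<^sup>*" using tree by (simp add: tree_arcs_def)
  ultimately obtain z where "z \<in> N x" by (auto elim: converse_rtranclE)
  then show ?thesis by (auto simp: deg_card card_gt_0_iff)
qed

lemma nonpendant_other:
  assumes "deg x \<noteq> 1" obtains z where "z \<in> N x" "z \<noteq> y"
proof -
  have "\<not> N x \<subseteq> {y}"
  proof
    assume "N x \<subseteq> {y}"
    then have "card (N x) \<le> 1" by (metis card_mono card.empty card.insert empty_iff finite.emptyI finite.insertI One_nat_def)
    then show False using deg_pos[of x] assms by (simp add: deg_card)
  qed
  then show ?thesis using that by blast
qed

lemma nonpendantI: "y \<in> N x \<Longrightarrow> z \<in> N x \<Longrightarrow> y \<noteq> z \<Longrightarrow> deg x \<noteq> 1"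
  unfolding deg_card by (metis card_1_singletonE singletonD)

lemma pendant_N: "deg x = 1 \<Longrightarrow> a \<in> N x \<Longrightarrow> N x = {a}"
  unfolding deg_card by (metis card_1_singletonE singletonD)

lemma pendant_eq: "deg x = 1 \<Longrightarrow> a \<in> N x \<Longrightarrow> (1 - \<alpha>) * f $ x = f $ a"
  using eigen_eq[of x] by (simp add: pendant_N algebra_simps)

text \<open>A vertex of maximal depth has no children, so only its parent can be a
  neighbour.\<close>

lemma ex_pendant: "\<exists>x. deg x = 1"
proof -
  obtain p where p: "rooted p undefined" "parcs T = parent_arcs p"
    using tree_arcs_imp_rooted[OF tree] by blast
  obtain d where d: "\<And>x. x \<noteq> undefined \<Longrightarrow> d (p x) < (d x :: nat)" using rooted_depth[OF p(1)] by blast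
  have "finite (range d)" "range d \<noteq> {}" by auto
  from Max_in[OF this] obtain x where "d x = Max (range d)" by (metis imageE)
  then have x: "d y \<le> d x" for y by simp
  have "N x \<subseteq> {p x}"
  proof
    fix y assume y: "y \<in> N x"
    then have "p y \<noteq> x"
      using d[of y] x[of y] p(1) by (cases "y = undefined") (auto simp: p(2) parent_arcs_def rooted_def)
    then show "y \<in> {p x}" using y by (auto simp: p(2) parent_arcs_def)
  qed
  then have "card (N x) \<le> 1" by (metis card_mono card.empty card.insert empty_iff finite.emptyI finite.insertI One_nat_def)
  then show ?thesis using deg_pos[of x] by (intro exI[of _ x]) (simp add: deg_card)
qed

text \<open>An edge between nonpendant vertices means that the tree is not a star, so the neighbour
  \<open>w\<close> of a leaf has degree at most \<open>n - 2\<close>. A test vector concentrated on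
  the leaf and \<open>w\<close> then has quotient below 1. Together with \<open>pendant_eq\<close>,
  this gives pendant vertices the sign of their neighbour and no smaller absolute value.\<close>

lemma \<alpha>_less_1:
  assumes xy: "y \<in> N x" "deg x \<noteq> 1" "deg y \<noteq> 1"
  shows "\<alpha> < 1"
proof -
  obtain l where l: "deg l = 1" using ex_pendant by blast
  then obtain w where w: "N l = {w}" by (metis card_1_singletonE deg_card)
  have lw: "l \<in> N w" "l \<noteq> w" using w N_sym N_irrefl by blast+
  \<comment> \<open>Were \<open>w\<close> adjacent to all others, a nonpendant \<open>a\<close> and
    a further neighbour \<open>b\<close> of it would form a triangle with \<open>w\<close>.\<close>
  have "\<exists>z. z \<noteq> w \<and> z \<notin> N w"
  proof (rule ccontr)
    assume "\<nexists>z. z \<noteq> w \<and> z \<notin> N w"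
    then have all: "z \<in> N w" if "z \<noteq> w" for z using that by blast
    obtain a where a: "a \<noteq> w" "deg a \<noteq> 1" using xy N_irrefl by metis
    obtain b where b: "b \<in> N a" "b \<noteq> w" using nonpendant_other[OF a(2)] by blast
    have "graph_path (parcs T) [w, a, b]"
      using a b all[OF a(1)] N_irrefl by auto
    from tree_arcs_length_2[OF tree this] all[OF b(2)] show False by simp
  qed
  then obtain z where z: "z \<noteq> w" "z \<notin> N w" by blast
  define n where "n = real CARD('v)"
  have "deg w + 2 \<le> CARD('v)"
  proof -
    have "card (N w) \<le> card (UNIV - {w, z})" using z N_irrefl by (intro card_mono) auto
    also have "\<dots> = CARD('v) - 2" using z by (simp add: card_Diff_subset)
    finally show ?thesis using card by (simp add: deg_card)
  qed
  then have dw: "real (deg w) \<le> n - 2" "2 \<le> n" unfolding n_def by linarith+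
  \<comment> \<open>The entries sum to \<open>n\<close>, so the mean is 1, and centring gives 0 at
    \<open>w\<close>, \<open>n - 2\<close> at \<open>l\<close> and -1 elsewhere.\<close>
  define h :: "real^'v" where "h = (\<chi> i. if i = w then 1 else if i = l then n - 1 else 0)"
  have h: "h $ w = 1" "h $ l = n - 1" "\<And>i. i \<noteq> w \<Longrightarrow> i \<noteq> l \<Longrightarrow> h $ i = 0" using lw by (auto simp: h_def)
  have two: "(\<Sum>i\<in>UNIV. h $ i * k i) = k w + (n - 1) * k l" for k :: "'v \<Rightarrow> real"
  proof -
    have "(\<Sum>i\<in>UNIV. h $ i * k i) = (\<Sum>i\<in>{w, l}. h $ i * k i)"
      using h by (intro sum.mono_neutral_right) auto
    then show ?thesis using h lw by simp
  qed
  have Lw: "(laplacian T *v h) $ w = real (deg w) - (n - 1)"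
  proof -
    have "h $ y = 0" if "y \<in> N w - {l}" for y using that h(3)[of y] N_irrefl[of w] by auto
    then have "(\<Sum>y\<in>N w. h $ y) = (\<Sum>y\<in>{l}. h $ y)"
      using lw by (intro sum.mono_neutral_right) auto
    then show ?thesis by (simp add: laplacian_mult sum_subtractf h deg_card)
  qed
  have Ll: "(laplacian T *v h) $ l = n - 2"
    by (simp add: laplacian_mult w h)
  have hL: "h \<bullet> (laplacian T *v h) = real (deg w) - (n - 1) + (n - 1) * (n - 2)"
    using two[of "\<lambda>i. (laplacian T *v h) $ i"] by (simp add: inner_vec_def Lw Ll)
  have hh: "h \<bullet> h = 1 + (n - 1) * (n - 1)"
    using two[of "\<lambda>i. h $ i"] by (simp add: inner_vec_def h)
  have hs: "(\<Sum>i\<in>UNIV. h $ i) = n" using two[of "\<lambda>i. 1"] by simp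
  have "\<alpha> * (1 + (n - 1) * (n - 1) - n\<^sup>2 / n) \<le> real (deg w) - (n - 1) + (n - 1) * (n - 2)"
    using laplacian_form_ge[OF tree card, of h] unfolding hL hh hs n_def[symmetric] .
  moreover have "1 + (n - 1) * (n - 1) - n\<^sup>2 / n = (n - 1) * (n - 2)"
    using dw by (simp add: power2_eq_square field_simps)
  ultimately have "\<alpha> * ((n - 1) * (n - 2)) \<le> real (deg w) - (n - 1) + (n - 1) * (n - 2)"
    by (simp only:)
  then have *: "\<alpha> * ((n - 1) * (n - 2)) < (n - 1) * (n - 2)" using dw by linarith
  show ?thesis
  proof (rule ccontr)
    assume "\<not> \<alpha> < 1"
    then have "1 * ((n - 1) * (n - 2)) \<le> \<alpha> * ((n - 1) * (n - 2))"
      using dw by (intro mult_right_mono) auto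
    then show False using * by simp
  qed
qed

text \<open>Isolating one neighbour turns the eigenvalue equation into a recursion: the slope along
  an edge is the sum of the onward slopes plus \<open>\<alpha> * f $ x\<close>.\<close>

lemma eigen_eq_remove:
  assumes "a \<in> N x"
  shows "f $ x - f $ a = \<alpha> * f $ x + (\<Sum>z\<in>N x - {a}. f $ z - f $ x)"
proof -
  have "(\<Sum>y\<in>N x. f $ x - f $ y) = (f $ x - f $ a) + (\<Sum>z\<in>N x - {a}. f $ x - f $ z)"
    using assms by (simp add: sum.remove)
  moreover have "(\<Sum>z\<in>N x - {a}. f $ x - f $ z) = - (\<Sum>z\<in>N x - {a}. f $ z - f $ x)"
    by (simp add: sum_subtractf)
  ultimately show ?thesis using eigen_eq[of x] by simp
qed

text \<open>Exchanging an onward branch \<open>z\<close> at \<open>a'\<close> with the branch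
  \<open>b'\<close> bounds every onward slope at \<open>a'\<close> by the slope to
  \<open>b'\<close>. These slopes are negative and \<open>\<alpha> * f $ a' \<le> 0\<close>, so the
  slope recursion passes the bound on to the edge into \<open>a'\<close>.\<close>

lemma descent_step:
  assumes \<alpha>: "\<alpha> < 1"
    and path: "graph_path (parcs T) (a' # mid @ [b'])" and mid: "mid \<noteq> []"
    and a: "0 \<le> f $ hd mid" "f $ a' < f $ hd mid" "f $ a' \<le> 0"
    and b: "0 \<le> f $ last mid" "f $ b' < f $ last mid"
  shows "f $ a' - f $ hd mid \<le> f $ b' - f $ last mid \<and>
    (f $ a' < f $ last mid \<longrightarrow> f $ a' - f $ hd mid < f $ b' - f $ last mid)"
proof -
  define Z where "Z = N a' - {hd mid}"
  obtain m ms where mid': "mid = m # ms" using mid by (cases mid) auto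
  have path': "graph_path (parcs T) (a' # m # ms @ [b'])" using path mid' by simp
  then have am: "hd mid \<in> N a'" using mid' by simp
  \<comment> \<open>With \<open>\<alpha> < 1\<close>, a pendant vertex has the sign of its neighbour
    and cannot lie strictly below it at a nonpositive value.\<close>
  have "deg a' \<noteq> 1"
  proof
    assume "deg a' = 1"
    from pendant_eq[OF this am] have "(1 - \<alpha>) * f $ a' = f $ hd mid" .
    moreover have "(1 - \<alpha>) * f $ a' \<le> 0" using \<alpha> a(3) by (simp add: mult_nonneg_nonpos)
    ultimately have "f $ hd mid = 0" "(1 - \<alpha>) * f $ a' = 0" using a(1) by linarith+
    then show False using \<alpha> a(2) by simp
  qed
  then obtain z0 where z0: "z0 \<in> Z" using nonpendant_other unfolding Z_def by blast
  have step: "sgn ((f $ b' - f $ last mid) - (f $ z - f $ a')) = sgn (f $ last mid - f $ a')" if "z \<in> Z" for z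
  proof -
    have pre: "graph_path (parcs T) (a' # mid)"
      using path graph_path_append[of _ "a' # mid" "[b']"] by simp
    have z: "z \<notin> set (a' # mid @ [b'])"
      using nbr_on_path[OF tree path', of z] that mid' by (auto simp: Z_def)
    have "b' \<notin> set (a' # mid)" "last mid \<noteq> a'" "b' \<in> N (last mid)"
      using path mid graph_path_append[of "parcs T" "a' # mid" "[b']"] by (auto simp: graph_path_def)
    then show ?thesis
      using exchange[OF pre, of a' "last mid" "{z}" "{b'}"] z that mid by (auto simp: Z_def)
  qed
  have le: "f $ z - f $ a' \<le> f $ b' - f $ last mid"
    "f $ a' < f $ last mid \<Longrightarrow> f $ z - f $ a' < f $ b' - f $ last mid" if "z \<in> Z" for z
    using step[OF that] a(3) b(1) by (auto simp: sgn_if split: if_splits)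
  have "(\<Sum>z\<in>Z. f $ z - f $ a') = (f $ z0 - f $ a') + (\<Sum>z\<in>Z - {z0}. f $ z - f $ a')"
    using z0 by (simp add: sum.remove)
  also have "\<dots> \<le> f $ z0 - f $ a'"
    using le(1) b(2) by (simp, intro sum_nonpos) force
  finally have "f $ a' - f $ hd mid \<le> \<alpha> * f $ a' + (f $ z0 - f $ a')"
    using eigen_eq_remove[OF am] by (simp add: Z_def)
  moreover have "\<alpha> * f $ a' \<le> 0" using \<alpha>_pos a(3) by (simp add: mult_nonneg_nonpos)
  ultimately show ?thesis using le[OF z0] by auto
qed

lemma descent_continues:
  assumes "a \<in> N x" "f $ x < f $ a" "0 < f $ x"
  obtains z where "z \<in> N x" "z \<noteq> a" "f $ z < f $ x"
proof -
  have "(\<Sum>z\<in>N x - {a}. f $ z - f $ x) < 0"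
    using eigen_eq_remove[OF assms(1)] assms(2,3) mult_pos_pos[OF \<alpha>_pos assms(3)] by linarith
  then obtain z where "z \<in> N x - {a}" "f $ z - f $ x < 0"
    by (meson not_less sum_nonneg)
  then show ?thesis using that by auto
qed

text \<open>Both descents can be prolonged until \<open>f\<close> becomes non-positive at the ends;
  then exchanging branches between the two ends gives contradictory strict inequalities.\<close>

lemma no_two_descents:
  assumes \<alpha>: "\<alpha> < 1"
    and path: "graph_path (parcs T) (a' # mid @ [b'])" and mid: "mid \<noteq> []"
    and a: "0 \<le> f $ hd mid" "f $ a' < f $ hd mid"
    and b: "0 \<le> f $ last mid" "f $ b' < f $ last mid"
  shows False
  using path mid a b
\<comment> \<open>The descents are prolonged at either end, so the middle part grows while staying
  shorter than the number of vertices.\<close>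
proof (induction "CARD('v) - length mid" arbitrary: a' mid b' rule: less_induct)
  case less
  have "length (a' # mid @ [b']) \<le> CARD('v)"
    using less.prems(1) by (metis card_mono distinct_card finite_code graph_path_def top_greatest)
  then have len: "CARD('v) - length (x # mid) < CARD('v) - length mid" for x by simp
  have rpath: "graph_path (parcs T) (b' # rev mid @ [a'])"
    using less.prems(1) graph_path_rev[OF symA, of "a' # mid @ [b']"] by simp
  consider "0 < f $ a'" | "0 < f $ b'" | "f $ a' \<le> 0" "f $ b' \<le> 0" by linarith
  then show ?case
  proof cases
    case 1
    obtain m ms where mid': "mid = m # ms" using less.prems by (cases mid) auto
    have "hd mid \<in> N a'" using less.prems(1) mid' by simp
    from descent_continues[OF this less.prems(4) 1]
    obtain z where z: "z \<in> N a'" "z \<noteq> m" "f $ z < f $ a'" using mid' by auto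
    have "z \<notin> set (a' # m # ms @ [b'])"
      using nbr_on_path[OF tree, of a' m "ms @ [b']" z] less.prems(1) z mid' by auto
    then have "graph_path (parcs T) (z # (a' # mid) @ [b'])"
      using less.prems(1) z(1) N_sym[of z a'] mid' by auto
    from less.hyps[OF len this] show ?thesis using less.prems 1 z by simp
  next
    case 2
    obtain m ms where mid': "rev mid = m # ms" using less.prems by (cases "rev mid") auto
    have m: "m = last mid" using mid' less.prems(2) by (metis hd_rev list.sel(1))
    have "m \<in> N b'" using rpath mid' by simp
    from descent_continues[OF this _ 2] less.prems(6)
    obtain z where z: "z \<in> N b'" "z \<noteq> m" "f $ z < f $ b'" using m by auto
    have "z \<notin> set (b' # m # ms @ [a'])"
      using nbr_on_path[OF tree, of b' m "ms @ [a']" z] rpath z mid' by auto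
    then have "graph_path (parcs T) (z # (b' # rev mid) @ [a'])"
      using rpath z(1) N_sym[of z b'] mid' by auto
    moreover have "CARD('v) - length (b' # rev mid) < CARD('v) - length mid" using len by simp
    ultimately show ?thesis
      using less.hyps[of "b' # rev mid" z a'] less.prems 2 z by (simp add: last_rev)
  next
    case 3
    \<comment> \<open>Applied from both ends, the step lemma gives opposite inequalities between the
      same two slopes. One of them is strict, whichever way \<open>f $ a'\<close> compares with
      \<open>f $ last mid\<close>.\<close>
    note s1 = descent_step[OF \<alpha> less.prems(1-4) 3(1) less.prems(5,6)]
    have s2: "f $ b' - f $ last mid \<le> f $ a' - f $ hd mid \<and>
      (f $ b' < f $ hd mid \<longrightarrow> f $ b' - f $ last mid < f $ a' - f $ hd mid)"
      using descent_step[OF \<alpha> rpath] less.prems 3 by (simp add: hd_rev last_rev)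
    show ?thesis
    proof (cases "f $ a' < f $ last mid")
      case True
      then show ?thesis using s1 s2 by linarith
    next
      case False
      then have "f $ b' < 0" using less.prems(5,6) 3 by linarith
      then show ?thesis using s1 s2 less.prems(3) by linarith
    qed
  qed
qed

text \<open>A path from \<open>x\<close> is followed to the first vertex \<open>w\<close> with
  nonzero value. If its predecessor is not \<open>x\<close> itself, both have value 0, so exchanging
  \<open>w\<close> with a neighbour \<open>r\<close> of \<open>x\<close> off the path forces equal
  values at \<open>w\<close> and \<open>r\<close>.\<close>

lemma no_zero_star:
  assumes x: "deg x \<noteq> 1" "f $ x = 0" and nb: "\<And>r. r \<in> N x \<Longrightarrow> f $ r = 0"
  shows False
proof -
  obtain w' where w': "f $ w' \<noteq> 0" using f_nonzero by (metis vec_eq_iff zero_index)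
  obtain ws where ws: "graph_path (parcs T) ws" "ws \<noteq> []" "hd ws = x" "last ws = w'"
    using graph_path_between[OF tree] by blast
  then have "\<exists>y\<in>set ws. f $ y \<noteq> 0" using w' by force
  then obtain ys w zs where eq: "ws = ys @ w # zs" and w: "f $ w \<noteq> 0" and ys: "\<And>y. y \<in> set ys \<Longrightarrow> f $ y = 0"
    using split_list_first_prop[of ws "\<lambda>y. f $ y \<noteq> 0"] by blast
  have ys0: "ys \<noteq> []" using eq ws(3) w x(2) by auto
  have path: "graph_path (parcs T) ys" "w \<notin> set ys" "w \<in> N (last ys)" "hd ys = x"
    using ws(1,3) ys0 unfolding eq graph_path_append by auto
  show False
  proof (cases "tl ys = []")
    case True
    then have "last ys = x" using ys0 path(4) by (cases ys) auto
    then show False using nb path(3) w by auto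
  next
    case False
    then obtain b bs where ys': "ys = x # b # bs" using path(4) ys0 by (cases ys; cases "tl ys") auto
    obtain r where r: "r \<in> N x" "r \<noteq> b" using nonpendant_other[OF x(1)] by blast
    have "r \<notin> set ys" using nbr_on_path[OF tree, of x b bs r] path(1) r ys' by auto
    moreover have "x \<noteq> last ys" using path(1) ys' by (auto simp: graph_path_def)
    moreover have "f $ last ys = 0" using ys ys0 by simp
    ultimately have "sgn (f $ w - f $ r) = 0"
      using exchange[OF path(1) ys0 path(4) refl, of "{r}" "{w}"] path r x(2) by auto
    then show False using nb[OF r(1)] w by (simp add: sgn_zero_iff)
  qed
qed

text \<open>For equal values the exchange rule makes all onward neighbours of \<open>x\<close> and
  \<open>y\<close> share one value. By the eigenvalue equation it is 0 if \<open>f $ x = 0\<close>,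
  against \<open>no_zero_star\<close>, and below \<open>f $ x\<close> otherwise, against
  \<open>no_two_descents\<close>.\<close>

lemma adjacent_neq_nonneg:
  assumes xy: "y \<in> N x" "deg x \<noteq> 1" "deg y \<noteq> 1" and x0: "0 \<le> f $ x"
  shows "f $ x \<noteq> f $ y"
proof
  assume eq: "f $ x = f $ y"
  have "x \<noteq> y" "x \<in> N y" using xy(1) N_irrefl N_sym by blast+
  have pxy: "graph_path (parcs T) [x, y]" using xy(1) \<open>x \<noteq> y\<close> by auto
  have same: "f $ z = f $ r" if "r \<in> N x - {y}" "z \<in> N y - {x}" for r z
  proof -
    have "sgn (f $ z - f $ y - (f $ r - f $ x)) = 0"
      using exchange[OF pxy, of x y "{r}" "{z}"] that \<open>x \<noteq> y\<close> eq N_irrefl by auto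
    then show ?thesis using eq by (simp add: sgn_zero_iff)
  qed
  obtain r where r: "r \<in> N x" "r \<noteq> y" using nonpendant_other[OF xy(2)] by blast
  obtain z where z: "z \<in> N y" "z \<noteq> x" using nonpendant_other[OF xy(3)] by blast
  have fr: "f $ r' = f $ r" if "r' \<in> N x - {y}" for r'
    using same[of r' z] same[of r z] that r z by auto
  have "0 = \<alpha> * f $ x + (\<Sum>z\<in>N x - {y}. f $ z - f $ x)"
    using eigen_eq_remove[OF xy(1)] eq by simp
  also have "(\<Sum>z\<in>N x - {y}. f $ z - f $ x) = real (card (N x - {y})) * (f $ r - f $ x)"
    using fr by simp
  finally have bal: "\<alpha> * f $ x = real (card (N x - {y})) * (f $ x - f $ r)"
    by (simp add: algebra_simps)
  have cpos: "0 < real (card (N x - {y}))" using r by (auto simp: card_gt_0_iff)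
  show False
  proof (cases "f $ x = 0")
    case True
    then have "real (card (N x - {y})) * (f $ x - f $ r) = 0" using bal by simp
    then have "f $ r = 0" using True cpos by (metis diff_0 mult_eq_0_iff neg_equal_0_iff_equal less_irrefl)
    then have "f $ r' = 0" if "r' \<in> N x" for r' using fr that eq True by (cases "r' = y") auto
    then show False using no_zero_star[OF xy(2) True] by blast
  next
    case False
    then have "0 < \<alpha> * f $ x" using \<alpha>_pos x0 by simp
    then have lt: "f $ r < f $ x" using bal cpos by (simp add: zero_less_mult_iff)
    moreover have "f $ z < f $ y" using same[of r z] r z lt eq by auto
    moreover have "graph_path (parcs T) (r # [x, y] @ [z])"
    proof -
      have "graph_path (parcs T) [x, y, z]" using xy(1) z \<open>x \<noteq> y\<close> N_irrefl[of y] by auto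
      moreover have "r \<notin> set [x, y, z]"
        using nbr_on_path[OF tree calculation, of r] r by auto
      ultimately show ?thesis using r(1) N_sym[of r x] by auto
    qed
    ultimately show False
      using no_two_descents[OF \<alpha>_less_1[OF xy], of r "[x, y]" z] x0 eq by simp
  qed
qed

text \<open>Exchanging \<open>y2\<close> at \<open>x\<close> with an onward branch at
  \<open>y1\<close> makes every onward slope at \<open>y1\<close> exceed the slope to
  \<open>y2\<close>; the slope recursion transfers this to the edge from \<open>x\<close> to
  \<open>y1\<close>. Of two nonpendant ascents, each would have to be the steeper one.\<close>

lemma ascent_step:
  assumes x: "0 \<le> f $ x" and y: "y1 \<in> N x" "y2 \<in> N x" "y1 \<noteq> y2" "deg y1 \<noteq> 1"
    and f: "f $ x < f $ y1" "f $ x < f $ y2"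
  shows "f $ y2 < f $ y1"
proof -
  have xy: "x \<in> N y1" "x \<noteq> y1" "x \<noteq> y2" using y N_sym N_irrefl by blast+
  define Z where "Z = N y1 - {x}"
  obtain z0 where z0: "z0 \<in> Z" using nonpendant_other[OF y(4)] unfolding Z_def by blast
  have path: "graph_path (parcs T) [y1, x]" using xy by auto
  have step: "f $ y2 - f $ x < f $ z - f $ y1" if "z \<in> Z" for z
  proof -
    have "sgn ((f $ y2 - f $ x) - (f $ z - f $ y1)) = sgn (f $ x - f $ y1)"
      using exchange[OF path, of y1 x "{z}" "{y2}"] that xy y N_irrefl by (auto simp: Z_def)
    then show ?thesis using f by (auto simp: sgn_if split: if_splits)
  qed
  have "(\<Sum>z\<in>Z. f $ z - f $ y1) = (f $ z0 - f $ y1) + (\<Sum>z\<in>Z - {z0}. f $ z - f $ y1)"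
    using z0 by (simp add: sum.remove)
  also have "\<dots> \<ge> f $ z0 - f $ y1"
    using step f by (simp, intro sum_nonneg) force
  finally have "f $ y1 - f $ x \<ge> \<alpha> * f $ y1 + (f $ z0 - f $ y1)"
    using eigen_eq_remove[OF xy(1)] by (simp add: Z_def)
  moreover have "0 \<le> \<alpha> * f $ y1" using \<alpha>_pos x f by simp
  ultimately show ?thesis using step[OF z0] by linarith
qed

text \<open>Two ascents contradict \<open>ascent_step\<close> used both ways; two descents
  contradict \<open>no_two_descents\<close> with \<open>x\<close> as the whole middle part.\<close>

lemma opposite_slopes_nonneg:
  assumes y: "y1 \<in> N x" "y2 \<in> N x" "y1 \<noteq> y2" "deg y1 \<noteq> 1" "deg y2 \<noteq> 1" and x0: "0 \<le> f $ x"
  shows "(f $ y1 - f $ x) * (f $ y2 - f $ x) < 0"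
proof -
  have dx: "deg x \<noteq> 1" using nonpendantI y by blast
  have ne: "f $ x \<noteq> f $ y1" "f $ x \<noteq> f $ y2" using adjacent_neq_nonneg y dx x0 by blast+
  have "\<not> (f $ x < f $ y1 \<and> f $ x < f $ y2)"
    using ascent_step[OF x0 y(1,2,3,4)] ascent_step[OF x0 y(2,1) y(3)[symmetric] y(5)] by force
  moreover have "\<not> (f $ y1 < f $ x \<and> f $ y2 < f $ x)"
  proof
    assume *: "f $ y1 < f $ x \<and> f $ y2 < f $ x"
    have "graph_path (parcs T) (y1 # [x] @ [y2])"
      using y N_sym[of y1 x] N_irrefl by auto
    then show False using no_two_descents[OF \<alpha>_less_1[OF y(1) dx y(4)], of y1 "[x]" y2] * x0 by simp
  qed
  ultimately show ?thesis using ne by (auto simp: mult_less_0_iff)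
qed

lemma opposite_slopes:
  assumes y: "y1 \<in> N x" "y2 \<in> N x" "y1 \<noteq> y2" "deg y1 \<noteq> 1" "deg y2 \<noteq> 1"
  shows "(f $ y1 - f $ x) * (f $ y2 - f $ x) < 0"
proof (cases "0 \<le> f $ x")
  case True
  then show ?thesis using opposite_slopes_nonneg y by blast
next
  case False
  interpret neg: minimal_tree T "- f" by (rule minimal_tree_uminus)
  show ?thesis using neg.opposite_slopes_nonneg[OF y] False by (auto simp: mult_less_0_iff)
qed

lemma adjacent_neq:
  assumes "y \<in> N x" "deg x \<noteq> 1" "deg y \<noteq> 1"
  shows "f $ x \<noteq> f $ y"
proof (cases "0 \<le> f $ x")
  case True
  then show ?thesis using adjacent_neq_nonneg assms by blast
next
  case False
  interpret neg: minimal_tree T "- f" by (rule minimal_tree_uminus)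
  show ?thesis using neg.adjacent_neq_nonneg[OF assms] False by simp
qed

text \<open>Three real numbers cannot have pairwise opposite signs. This is what rules out branching
  among nonpendant vertices.\<close>

lemma two_nonpendant_nbrs:
  assumes "a \<in> N x" "b \<in> N x" "c \<in> N x" "deg a \<noteq> 1" "deg b \<noteq> 1" "deg c \<noteq> 1" "a \<noteq> b" "a \<noteq> c" "b \<noteq> c"
  shows False
  using opposite_slopes[of a x b] opposite_slopes[of a x c] opposite_slopes[of b x c] assms
  by (auto simp: mult_less_0_iff)

end

section \<open>The spine\<close>

context minimal_tree
begin

lemma nonpendant_path:
  assumes "graph_path (parcs T) zs" "zs \<noteq> []" "deg (hd zs) \<noteq> 1" "deg (last zs) \<noteq> 1" "y \<in> set zs"
  shows "deg y \<noteq> 1"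
proof -
  obtain as bs where eq: "zs = as @ y # bs" using assms(5) by (meson split_list)
  consider "as = []" | "bs = []" | a' as' b bs' where "as = as' @ [a']" "bs = b # bs'"
    by (metis neq_Nil_conv rev_exhaust)
  then show ?thesis
  proof cases
    case 3
    then have "graph_path (parcs T) (as' @ [a', y, b] @ bs')" using assms(1) eq by simp
    then have "graph_path (parcs T) [a', y, b]" unfolding graph_path_append by blast
    then have "a' \<in> N y" "b \<in> N y" "a' \<noteq> b" using N_sym[of a' y] by auto
    then show ?thesis by (rule nonpendantI)
  qed (use assms eq in auto)
qed

text \<open>A longest path of nonpendant vertices is taken. A missing one would be joined to it by a
  path that leaves it at \<open>last ys\<close>; at an end this lengthens the path, in the interior
  it creates a third nonpendant neighbour.\<close>

lemma spine_exists:
  obtains ws where "graph_path (parcs T) ws" "set ws = {x. deg x \<noteq> 1}"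
proof -
  define P where "P ws \<longleftrightarrow> graph_path (parcs T) ws \<and> set ws \<subseteq> {x. deg x \<noteq> 1}" for ws
  have "length ws < Suc CARD('v)" if "P ws" for ws
    using that unfolding P_def graph_path_def less_Suc_eq_le
    by (metis card_mono distinct_card finite_code top_greatest)
  moreover have "P []" by (simp add: P_def)
  ultimately obtain ws where ws: "P ws" and max: "\<And>zs. P zs \<Longrightarrow> length zs \<le> length ws"
    using ex_has_greatest_nat[of P "[]" length "Suc CARD('v)"] by blast
  have path: "graph_path (parcs T) ws" and np: "\<And>x. x \<in> set ws \<Longrightarrow> deg x \<noteq> 1"
    using ws by (auto simp: P_def)
  have "q \<in> set ws" if q: "deg q \<noteq> 1" for q
  proof (rule ccontr)
    assume nin: "q \<notin> set ws"
    have ws0: "ws \<noteq> []" using max[of "[q]"] q by (auto simp: P_def)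
    obtain zs where zs: "graph_path (parcs T) zs" "zs \<noteq> []" "hd zs = hd ws" "last zs = q"
      using graph_path_between[OF tree] by blast
    have npz: "deg y \<noteq> 1" if "y \<in> set zs" for y
      using nonpendant_path[OF zs(1,2) _ _ that] zs(3,4) q np ws0 by simp
    have "\<exists>y\<in>set zs. y \<notin> set ws" using zs nin by (metis last_in_set)
    then obtain ys w rest where eq: "zs = ys @ w # rest" and w: "w \<notin> set ws"
      and ys: "\<And>y. y \<in> set ys \<Longrightarrow> y \<in> set ws"
      using split_list_first_prop[of zs "\<lambda>y. y \<notin> set ws"] by blast
    have "ys \<noteq> []" using eq zs(3) w ws0 by (cases ys) auto
    then have t: "last ys \<in> set ws" "w \<in> N (last ys)" "deg w \<noteq> 1"
      using ys zs(1) npz unfolding eq by (auto simp: graph_path_append)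
    obtain as bs where ws': "ws = as @ last ys # bs" using t(1) by (meson split_list)
    consider "as = []" | "bs = []" | a' as' b bs' where "as = as' @ [a']" "bs = b # bs'"
      by (metis neq_Nil_conv rev_exhaust)
    then show False
    proof cases
      case 1
      then have "P (w # ws)" using t w path np N_sym[of w "last ys"] by (auto simp: P_def ws')
      then show False using max by fastforce
    next
      case 2
      then have "P (ws @ [w])" using t w path np by (auto simp: P_def ws' graph_path_append)
      then show False using max by fastforce
    next
      case 3
      then have "graph_path (parcs T) (as' @ [a', last ys, b] @ bs')" using path ws' by simp
      then have "graph_path (parcs T) [a', last ys, b]" unfolding graph_path_append by blast
      then have "a' \<in> N (last ys)" "b \<in> N (last ys)" "a' \<noteq> b" using N_sym[of a' "last ys"] by auto
      moreover have "a' \<in> set ws" "b \<in> set ws" using ws' 3 by auto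
      ultimately show False using two_nonpendant_nbrs[of a' "last ys" b w] t np w by blast
    qed
  qed
  then have "set ws = {x. deg x \<noteq> 1}" using np by blast
  then show ?thesis using that path by blast
qed

lemma caterpillar_T:
  assumes "pverts T = UNIV" shows "caterpillar T"
proof -
  obtain ws where ws: "graph_path (parcs T) ws" "set ws = {x. deg x \<noteq> 1}" using spine_exists by blast
  have "pverts T - pendant_vertices T = set ws" using ws(2) assms by (auto simp: pendant_vertices_def)
  then show ?thesis
    using path_along_induced[OF tree ws(1)] tree is_tree_iff_tree_arcs[OF assms]
    unfolding caterpillar_def by metis
qed

text \<open>Opposite slopes at each inner vertex propagate the direction of the first edge.\<close>

lemma spine_monotone:
  assumes "graph_path (parcs T) (x # y # zs)" "set (x # y # zs) \<subseteq> {x. deg x \<noteq> 1}" "f $ x < f $ y"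
  shows "successively (\<lambda>a b. f $ a < f $ b) (x # y # zs)"
  using assms
proof (induction zs arbitrary: x y)
  case (Cons z zs)
  have "x \<in> N y" "z \<in> N y" "x \<noteq> z" using Cons.prems(1) N_sym[of x y] by auto
  then have "(f $ x - f $ y) * (f $ z - f $ y) < 0" using opposite_slopes Cons.prems(2) by simp
  then have "f $ y < f $ z" using Cons.prems(3) by (auto simp: mult_less_0_iff)
  then show ?case using Cons.IH[of y z] Cons.prems by simp
qed simp

lemma increasing_spine:
  obtains ws where "graph_path (parcs T) ws" "set ws = {x. deg x \<noteq> 1}"
    "successively (\<lambda>a b. f $ a < f $ b) ws"
proof -
  obtain ws where ws: "graph_path (parcs T) ws" "set ws = {x. deg x \<noteq> 1}" using spine_exists by blast
  have rws: "graph_path (parcs T) (rev ws)" "set (rev ws) = {x. deg x \<noteq> 1}"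
    using ws graph_path_rev[OF symA] by auto
  consider "ws = []" | x where "ws = [x]" | x y zs where "ws = x # y # zs" by (metis neq_Nil_conv)
  then show ?thesis
  proof cases
    case (3 x y zs)
    have sub: "set (x # y # zs) \<subseteq> {x. deg x \<noteq> 1}" using ws(2) 3 by simp
    have "y \<in> N x" "deg x \<noteq> 1" "deg y \<noteq> 1" using ws 3 by auto
    then have "f $ x \<noteq> f $ y" by (rule adjacent_neq)
    then consider "f $ x < f $ y" | "f $ y < f $ x" by linarith
    then show ?thesis
    proof cases
      case 1
      then show ?thesis using that[OF ws] spine_monotone[OF ws(1)[unfolded 3] sub 1] 3 by blast
    next
      case 2
      interpret neg: minimal_tree T "- f" by (rule minimal_tree_uminus)
      have "successively (\<lambda>a b. (- f) $ a < (- f) $ b) ws"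
        using neg.spine_monotone[OF ws(1)[unfolded 3] sub] 2 unfolding 3 by simp
      then have "successively (\<lambda>a b. f $ a < f $ b) (rev ws)" by simp
      then show ?thesis using that[OF rws] by blast
    qed
  next
    case 1
    then show ?thesis using that[OF ws] by simp
  next
    case (2 x)
    then show ?thesis using that[OF ws] by simp
  qed
qed

text \<open>If the degree dropped, handing the surplus in pendant neighbours from \<open>x\<close>
  to \<open>y\<close> would swap the two degrees, and the exchange rule would make the sum of the
  slopes to them negative. But these slopes are nonnegative because
  \<open>\<alpha> < 1\<close>.\<close>

lemma degree_mono:
  assumes xy: "y \<in> N x" "deg x \<noteq> 1" "deg y \<noteq> 1" and fx: "0 \<le> f $ x" "f $ x < f $ y"
  shows "deg x \<le> deg y"
proof (rule ccontr)
  assume "\<not> deg x \<le> deg y"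
  define k where "k = deg x - deg y"
  have k: "k + deg y = deg x" "0 < k" using \<open>\<not> deg x \<le> deg y\<close> by (auto simp: k_def)
  have xy': "x \<noteq> y" using xy N_irrefl by blast
  define Q where "Q = {r \<in> N x. deg r = 1}"
  define M where "M = {r \<in> N x. deg r \<noteq> 1}"
  \<comment> \<open>With at most two nonpendant neighbours and \<open>deg y\<close> at least 2, the
    surplus can be taken from pendant neighbours alone.\<close>
  have "card M \<le> 2"
  proof (rule ccontr)
    assume "\<not> card M \<le> 2"
    then have "\<not> M \<subseteq> {y}" by (metis card_mono card_1_singleton_iff finite.emptyI finite.insertI One_nat_def le_trans one_le_numeral)
    then obtain a where a: "a \<in> M" "a \<noteq> y" by blast
    have "\<not> M \<subseteq> {y, a}"
    proof
      assume "M \<subseteq> {y, a}"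
      then have "card M \<le> card {y, a}" by (intro card_mono) auto
      then show False using \<open>\<not> card M \<le> 2\<close> a by simp
    qed
    then obtain b where "b \<in> M" "b \<noteq> y" "b \<noteq> a" by blast
    then show False using two_nonpendant_nbrs[of y x a b] a xy by (auto simp: M_def)
  qed
  moreover have "deg x = card Q + card M"
  proof -
    have "N x = Q \<union> M" "Q \<inter> M = {}" by (auto simp: Q_def M_def)
    then show ?thesis by (simp add: deg_card card_Un_disjoint)
  qed
  moreover have "2 \<le> deg y" using deg_pos[of y] xy(3) by linarith
  ultimately have "k \<le> card Q" using k by linarith
  then obtain R where R: "R \<subseteq> Q" "card R = k" by (meson obtain_subset_with_card_n)
  have "R \<noteq> {}" using R k by auto
  have "graph_path (parcs T) [x, y]" using xy xy' by auto
  moreover have "R \<subseteq> N x - set [x, y]" using R xy(3) N_irrefl by (auto simp: Q_def)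
  ultimately have "sgn ((\<Sum>s\<in>{}. f $ s - f $ y) - (\<Sum>r\<in>R. f $ r - f $ x)) = sgn (f $ y - f $ x)"
    using exchange[of "[x, y]" x y R "{}"] xy' \<open>R \<noteq> {}\<close> R k by simp
  then have neg: "(\<Sum>r\<in>R. f $ r - f $ x) < 0" using fx by (auto simp: sgn_if split: if_splits)
  have "0 \<le> f $ r - f $ x" if "r \<in> R" for r
  proof -
    have r: "deg r = 1" "x \<in> N r" using that R N_sym by (auto simp: Q_def)
    have "\<alpha> < 1" using \<alpha>_less_1 xy by blast
    have eq: "(1 - \<alpha>) * f $ r = f $ x" by (rule pendant_eq[OF r])
    then have "0 \<le> f $ r" using fx(1) \<open>\<alpha> < 1\<close> by (metis diff_gt_0_iff_gt zero_le_mult_iff not_less)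
    then have "0 \<le> \<alpha> * f $ r" using \<alpha>_pos by simp
    then show ?thesis using eq by (simp add: algebra_simps)
  qed
  then have "0 \<le> (\<Sum>r\<in>R. f $ r - f $ x)" by (rule sum_nonneg)
  then show False using neg by simp
qed

text \<open>A path from \<open>v\<close> to \<open>h\<close> first reaches \<open>a\<close> and
  either ends there or leaves it by a second neighbour. The vertex \<open>h\<close> rules out the
  tree with a single edge.\<close>

lemma pendant_nbr:
  assumes "deg v = 1" "a \<in> N v" "deg h \<noteq> 1"
  shows "deg a \<noteq> 1"
proof -
  obtain zs where zs: "graph_path (parcs T) zs" "zs \<noteq> []" "hd zs = v" "last zs = h"
    using graph_path_between[OF tree] by blast
  have "h \<noteq> v" using assms by auto
  then obtain b bs where eq: "zs = v # b # bs" using zs by (metis last.simps neq_Nil_conv list.sel(1))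
  then have ba: "b = a" using zs(1) pendant_N[OF assms(1,2)] by auto
  show ?thesis
  proof (cases bs)
    case Nil
    then show ?thesis using eq ba zs(4) assms(3) by simp
  next
    case (Cons c cs)
    then have "v \<in> N a" "c \<in> N a" "v \<noteq> c" using eq ba zs(1) N_sym[of v a] by auto
    then show ?thesis by (rule nonpendantI)
  qed
qed

text \<open>On the increasing spine the nonnegative values form a final segment \<open>ys\<close>.
  Degrees grow along it by \<open>degree_mono\<close>, and its head is either a zero of
  \<open>f\<close> or has a negative neighbour.\<close>

lemma nonneg_path:
  assumes U: "pverts T = UNIV"
  shows "\<exists>vs. path_along (with_proj T \<restriction> ({v. 0 \<le> f $ v} - pendant_vertices T)) vs \<and>
     sorted (map deg vs) \<and>
     (vs \<noteq> [] \<longrightarrow> characteristic_vertex T f (hd vs) \<or> (\<exists>w. characteristic_edge T f (hd vs) w))"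
proof -
  obtain ws where ws: "graph_path (parcs T) ws" "set ws = {x. deg x \<noteq> 1}"
    "successively (\<lambda>a b. f $ a < f $ b) ws" using increasing_spine by blast
  define pre ys where "pre = takeWhile (\<lambda>x. f $ x < 0) ws" and "ys = dropWhile (\<lambda>x. f $ x < 0) ws"
  have eq: "ws = pre @ ys" by (simp add: pre_def ys_def)
  have path: "graph_path (parcs T) ys" and inc: "successively (\<lambda>a b. f $ a < f $ b) ys"
    using ws(1,3) unfolding eq by (simp_all add: graph_path_append successively_append_iff)
  have np: "x \<in> set ws \<longleftrightarrow> deg x \<noteq> 1" for x using ws(2) by blast
  have swrt: "sorted_wrt (\<lambda>a b. f $ a < f $ b) ws"
    using ws(3) by (subst (asm) successively_conv_sorted_wrt) (auto intro: transpI)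
  have inj: "x = y" if "x \<in> set ws" "y \<in> set ws" "f $ x = f $ y" for x y
  proof -
    obtain i j where ij: "i < length ws" "j < length ws" "x = ws ! i" "y = ws ! j"
      using \<open>x \<in> set ws\<close> \<open>y \<in> set ws\<close> by (auto simp: in_set_conv_nth)
    then show ?thesis using that(3) sorted_wrt_nth_less[OF swrt, of i j] sorted_wrt_nth_less[OF swrt, of j i]
      by (cases i j rule: linorder_cases) auto
  qed
  have neg: "f $ x < 0" if "x \<in> set pre" for x
    using that unfolding pre_def by (rule set_takeWhileD[THEN conjunct2])
  have hd_ge: "0 \<le> f $ hd ys" if "ys \<noteq> []"
    using hd_dropWhile[of "\<lambda>x. f $ x < 0" ws] that by (auto simp: ys_def)
  have ge_hd: "f $ hd ys \<le> f $ x" if "x \<in> set ys" for x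
    using that swrt unfolding eq by (cases ys) (auto simp: sorted_wrt_append less_imp_le)
  have nonneg: "0 \<le> f $ x" if "x \<in> set ys" for x
    using hd_ge ge_hd[OF that] that by (cases ys) auto
  have "{v. 0 \<le> f $ v} - pendant_vertices T = set ys"
  proof (intro set_eqI iffI)
    fix x assume "x \<in> {v. 0 \<le> f $ v} - pendant_vertices T"
    then have "x \<in> set ws" "0 \<le> f $ x" using U by (auto simp: np pendant_vertices_def)
    then show "x \<in> set ys" using neg[of x] unfolding eq by auto
  next
    fix x assume "x \<in> set ys"
    then show "x \<in> {v. 0 \<le> f $ v} - pendant_vertices T"
      using nonneg np[of x] U unfolding eq by (auto simp: pendant_vertices_def)
  qed
  then have 1: "path_along (with_proj T \<restriction> ({v. 0 \<le> f $ v} - pendant_vertices T)) ys"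
    using path_along_induced[OF tree path] by simp
  have "successively (\<lambda>a b. deg a \<le> deg b) ys"
    unfolding successively_conv_nth
  proof (intro allI impI)
    fix i assume i: "Suc i < length ys"
    have mem: "ys ! i \<in> set ys" "ys ! Suc i \<in> set ys" using i by auto
    then have "deg (ys ! i) \<noteq> 1" "deg (ys ! Suc i) \<noteq> 1" using np unfolding eq by auto
    moreover have "ys ! Suc i \<in> N (ys ! i)"
      using path i by (auto simp: graph_path_def successively_conv_nth)
    moreover have "f $ (ys ! i) < f $ (ys ! Suc i)" using successively_nth[OF inc i] .
    ultimately show "deg (ys ! i) \<le> deg (ys ! Suc i)"
      using degree_mono nonneg[OF mem(1)] by blast
  qed
  then have 2: "sorted (map deg ys)"
    by (subst successively_conv_sorted_wrt[symmetric]) (auto simp: successively_map intro: transpI)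
  have 3: "characteristic_vertex T f (hd ys) \<or> (\<exists>w. characteristic_edge T f (hd ys) w)" if ys0: "ys \<noteq> []"
  proof (cases "f $ hd ys = 0")
    case True
    have hws: "hd ys \<in> set ws" using ys0 unfolding eq by auto
    then have "\<exists>r\<in>N (hd ys). f $ r \<noteq> 0" using no_zero_star[OF _ True] np by blast
    \<comment> \<open>By \<open>pendant_eq\<close> a zero vertex with a nonzero neighbour is
      nonpendant, and \<open>f\<close> is injective on the spine.\<close>
    moreover have "v = hd ys" if v: "f $ v = 0" "w \<in> N v" "f $ w \<noteq> 0" for v w
    proof -
      have "deg v \<noteq> 1" using pendant_eq[of v w] v by auto
      then show ?thesis using inj[of v "hd ys"] hws True v np by auto
    qed
    ultimately have "{v \<in> pverts T. f $ v = 0 \<and> (\<exists>w. (v, w) \<in> parcs T \<and> f $ w \<noteq> 0)} = {hd ys}"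
      using True U by blast
    then show ?thesis by (simp add: characteristic_vertex_def)
  next
    case False
    then have hpos: "0 < f $ hd ys" using hd_ge ys0 by simp
    have hws: "hd ys \<in> set ws" using ys0 unfolding eq by auto
    have "\<exists>w\<in>N (hd ys). f $ w < 0"
    proof (cases "pre = []")
      case False
      then have "last pre \<in> N (hd ys)" using ws(1) ys0 N_sym[of "last pre" "hd ys"] unfolding eq graph_path_append by auto
      then show ?thesis using neg[of "last pre"] False by auto
    next
      case True
      \<comment> \<open>With a positive spine, a negative vertex, which exists as \<open>f\<close>
        sums to 0, is pendant. Were it attached elsewhere than at \<open>hd ys\<close>, the spine
        would contain an edge, so \<open>\<alpha> < 1\<close> and the vertex would have the sign of
        its neighbour.\<close>
      have pos: "0 < f $ x" if "x \<in> set ws" for x using ge_hd[of x] hpos that True eq by simp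
      obtain v where v: "f $ v < 0"
      proof (rule ccontr)
        assume "\<not> thesis"
        then have "0 \<le> f $ v" for v using that by (meson not_less)
        then have "f $ v = 0" for v using sum_f by (subst (asm) sum_nonneg_eq_0_iff) auto
        then show False using hpos by simp
      qed
      then have dv: "deg v = 1" using pos[of v] np by fastforce
      then obtain a where a: "N v = {a}" by (metis card_1_singletonE deg_card)
      have da: "deg a \<noteq> 1" using pendant_nbr[OF dv, of a "hd ys"] a hws np by blast
      show ?thesis
      proof (cases "a = hd ys")
        case True
        then show ?thesis using a v N_sym by (metis singletonI)
      next
        case False
        have "a \<in> set ws" using da np by simp
        then obtain x y zs where "ws = x # y # zs" using False hws
          by (metis list.set_cases set_ConsD neq_Nil_conv)
        then have "\<alpha> < 1" using \<alpha>_less_1[of y x] ws(1) np by auto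
        moreover have "(1 - \<alpha>) * f $ v = f $ a" using pendant_eq[OF dv, of a] a by simp
        moreover have "0 < f $ a" using pos \<open>a \<in> set ws\<close> by simp
        ultimately show ?thesis using v by (smt (verit) mult_pos_neg)
      qed
    qed
    then obtain w where "w \<in> N (hd ys)" "f $ w < 0" by blast
    then have "characteristic_edge T f (hd ys) w"
      using hpos by (auto simp: characteristic_edge_def mult_pos_neg)
    then show ?thesis by blast
  qed
  show ?thesis using 1 2 3 by blast
qed

end

theorem theorem1:
  fixes \<pi> :: "nat list" and T :: "'v::finite pair_pre_digraph"
  assumes "tree_sequence \<pi>"
    and "2 \<le> length \<pi>"
    and "T \<in> trees_with_degree_sequence \<pi>"
    and "\<forall>T' \<in> (trees_with_degree_sequence \<pi> :: 'v pair_pre_digraph set).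
           algebraic_connectivity T \<le> algebraic_connectivity T'"
  shows "caterpillar T \<and>
    (\<forall>f. fiedler_vector T f \<longrightarrow>
      (\<forall>S \<in> {{v. 0 \<le> f $ v}, {v. f $ v \<le> 0}}.
        \<exists>vs. path_along (with_proj T \<restriction> (S - pendant_vertices T)) vs \<and>
             sorted (map (vertex_degree T) vs) \<and>
             (vs \<noteq> [] \<longrightarrow>
               characteristic_vertex T f (hd vs) \<or> (\<exists>w. characteristic_edge T f (hd vs) w))))"
proof -
  have U: "pverts T = UNIV" and "is_tree T"
    and deg: "image_mset (vertex_degree T) (mset_set UNIV) = mset \<pi>"
    using assms(3) by (auto simp: trees_with_degree_sequence_def has_degree_sequence_def)
  then have tree: "tree_arcs (parcs T)" by (simp add: is_tree_iff_tree_arcs)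
  have "CARD('v) = length \<pi>" using arg_cong[OF deg, of size] by simp
  then have card: "2 \<le> CARD('v)" using assms(2) by simp
  have min: "minimal_tree T f" if "fiedler_vector T f" for f
  proof
    fix T' :: "'v pair_pre_digraph"
    assume *: "tree_arcs (parcs T')" "pverts T' = UNIV"
      "image_mset (vertex_degree T') (mset_set UNIV) = image_mset (vertex_degree T) (mset_set UNIV)"
    then have "T' \<in> trees_with_degree_sequence \<pi>"
      using deg by (simp add: trees_with_degree_sequence_def has_degree_sequence_def is_tree_iff_tree_arcs)
    then show "algebraic_connectivity T \<le> algebraic_connectivity T'" using assms(4) by blast
  qed (fact tree card that)+
  \<comment> \<open>The caterpillar claim mentions no vector, but the locale needs one.\<close>
  obtain f where "fiedler_vector T f" using tree_laplacian_spectrum(2)[OF tree card] by blast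
  then have "caterpillar T" using minimal_tree.caterpillar_T[OF min U] by blast
  moreover have "\<exists>vs. path_along (with_proj T \<restriction> (S - pendant_vertices T)) vs \<and>
             sorted (map (vertex_degree T) vs) \<and>
             (vs \<noteq> [] \<longrightarrow>
               characteristic_vertex T f (hd vs) \<or> (\<exists>w. characteristic_edge T f (hd vs) w))"
    if f: "fiedler_vector T f" and S: "S \<in> {{v. 0 \<le> f $ v}, {v. f $ v \<le> 0}}" for f S
  proof -
    interpret minimal_tree T f by (rule min[OF f])
    interpret neg: minimal_tree T "- f" by (rule minimal_tree_uminus)
    \<comment> \<open>The nonpositive side of \<open>f\<close> is the nonnegative side of
      \<open>- f\<close>, and both characteristic notions are unaffected by the sign.\<close>
    have "characteristic_vertex T (- f) = characteristic_vertex T f"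
      "characteristic_edge T (- f) = characteristic_edge T f"
      by (simp_all add: characteristic_vertex_def characteristic_edge_def fun_eq_iff)
    then show ?thesis using S nonneg_path[OF U] neg.nonneg_path[OF U] by auto
  qed
  ultimately show ?thesis by blast
qed

end
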